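(* Let $k$ be a field of characteristic $2$ and let $P$ be a finite $2$-group. If the directed graph $\Gamma_2(P)$ has a directed cycle, then the Lie algebra $\operatorname{HH}^1(kP)$ is not solvable.
   Context: For a $k$-algebra $A$, $\operatorname{HH}^1(A)=\operatorname{Der}(A)/\operatorname{InnDer}(A)$, where $\operatorname{Der}(A)$ is the Lie algebra of $k$-linear derivations $A\to A$ with the commutator bracket and $\operatorname{InnDer}(A)$ is the ideal of derivations $a\mapsto xa-ax$ with $x\in A$; this quotient is a Lie algebra. For a group $H$, write $H'=[H,H]$. For a finite group $G$ and a subgroup $H\le G$, the transfer $\operatorname{tr}_H^G:G\to H/H'$ is the group homomorphism defined as follows: choose a right transversal $t_1,\dots,t_m$ of $H$ in $G$; for $g\in G$ write $t_i g=g_{[i]}t_j$ with $g_{[i]}\in H$ (and $j$ depending on $i$); then $\operatorname{tr}_H^G(g)=\left(\prod_{i=1}^m g_{[i]}\right)H'$. $C_P(x)$ is the centralizer of $x$ in $P$ and $\Phi(\cdot)$ denotes the Frattini subgroup of a finite $2$-group. $\Gamma(P)$ is the directed graph whose vertices are the elements of $P/\Phi(P)$, with an edge $a\to b$ (possibly $a=b$) exactly when there are $x,y\in P$ with images $a,b$ respectively in $P/\Phi(P)$ such that $\operatorname{tr}_{C_P(x)}^P(y)\notin\Phi(C_P(x)/C_P(x)')$. $\Gamma_2(P)$ is the directed graph whose vertices are the elements of $P/\Phi(P)$, with an edge $a\rightsquigarrow b$ exactly when both edges $a\to b$ and $a\to ab$ are in $\Gamma(P)$. *)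

theory Defs
  imports "HOL-Algebra.Algebra" "Graph_Theory.Pair_Digraph"
begin

section \<open>Lie algebras and the first Hochschild cohomology\<close>

text \<open>
  A Lie algebra over \<open>R\<close> is represented by a \<^typ>\<open>('k, 'l) module\<close> record whose multiplication
  \<open>\<otimes>\<close> is the Lie bracket. Its \<open>one\<close> field has no meaning and is never used.
\<close>

definition lie_derived ::
  "('k, 'n) ring_scheme \<Rightarrow> ('k, 'l, 'm) module_scheme \<Rightarrow> 'l set \<Rightarrow> 'l set"
  where "lie_derived R L S =
    (\<lambda>N. submodule N R L) hull {x \<otimes>\<^bsub>L\<^esub> y | x y. x \<in> S \<and> y \<in> S}"

definition lie_solvable :: "('k, 'n) ring_scheme \<Rightarrow> ('k, 'l, 'm) module_scheme \<Rightarrow> bool"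
  where "lie_solvable R L \<longleftrightarrow> (\<exists>n. (lie_derived R L ^^ n) (carrier L) = {\<zero>\<^bsub>L\<^esub>})"

text \<open>
  Derivations are extensional functions, so that each derivation is represented exactly once.
\<close>

definition derivations ::
  "('k, 'n) ring_scheme \<Rightarrow> ('k, 'a, 'm) module_scheme \<Rightarrow> ('a \<Rightarrow> 'a) set"
  where "derivations R A = {d \<in> carrier A \<rightarrow>\<^sub>E carrier A.
    (\<forall>x\<in>carrier A. \<forall>y\<in>carrier A. d (x \<oplus>\<^bsub>A\<^esub> y) = d x \<oplus>\<^bsub>A\<^esub> d y) \<and>
    (\<forall>c\<in>carrier R. \<forall>x\<in>carrier A. d (c \<odot>\<^bsub>A\<^esub> x) = c \<odot>\<^bsub>A\<^esub> d x) \<and>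
    (\<forall>x\<in>carrier A. \<forall>y\<in>carrier A. d (x \<otimes>\<^bsub>A\<^esub> y) = d x \<otimes>\<^bsub>A\<^esub> y \<oplus>\<^bsub>A\<^esub> x \<otimes>\<^bsub>A\<^esub> d y)}"

definition Der ::
  "('k, 'n) ring_scheme \<Rightarrow> ('k, 'a, 'm) module_scheme \<Rightarrow> ('k, 'a \<Rightarrow> 'a) module"
  where "Der R A =
    \<lparr>carrier = derivations R A,
     monoid.mult = (\<lambda>d e. \<lambda>x\<in>carrier A. d (e x) \<ominus>\<^bsub>A\<^esub> e (d x)),
     one = undefined,
     ring.zero = (\<lambda>x\<in>carrier A. \<zero>\<^bsub>A\<^esub>),
     ring.add = (\<lambda>d e. \<lambda>x\<in>carrier A. d x \<oplus>\<^bsub>A\<^esub> e x),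
     smult = (\<lambda>c d. \<lambda>x\<in>carrier A. c \<odot>\<^bsub>A\<^esub> d x)\<rparr>"

definition InnDer :: "('k, 'a, 'm) module_scheme \<Rightarrow> ('a \<Rightarrow> 'a) set"
  where "InnDer A = (\<lambda>x. \<lambda>a\<in>carrier A. x \<otimes>\<^bsub>A\<^esub> a \<ominus>\<^bsub>A\<^esub> a \<otimes>\<^bsub>A\<^esub> x) ` carrier A"

text \<open>
  The library quotient \<open>L Quot I\<close> by an ideal, together with the induced scalar multiplication.
\<close>

definition quot_algebra ::
  "('k, 'l, 'm) module_scheme \<Rightarrow> 'l set \<Rightarrow> ('k, 'l set) module"
  where "quot_algebra L I =
    ring.extend (L Quot I)
      (module.fields (\<lambda>c C. \<Union>x\<in>C. I +>\<^bsub>L\<^esub> (c \<odot>\<^bsub>L\<^esub> x)))"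

definition HH1 ::
  "('k, 'n) ring_scheme \<Rightarrow> ('k, 'a, 'm) module_scheme \<Rightarrow> ('k, ('a \<Rightarrow> 'a) set) module"
  where "HH1 R A = quot_algebra (Der R A) (InnDer A)"

text \<open>
  The group algebra \<open>kG\<close> of a finite group \<open>G\<close>: the function \<open>a\<close> stands for the formal sum of
  the terms \<open>a g \<cdot> g\<close>. Finiteness of \<open>G\<close> matters, as no finite-support condition is imposed.
\<close>

definition group_algebra ::
  "('k, 'n) ring_scheme \<Rightarrow> ('g, 'm) monoid_scheme \<Rightarrow> ('k, 'g \<Rightarrow> 'k) module"
  where "group_algebra k G =
    \<lparr>carrier = carrier G \<rightarrow>\<^sub>E carrier k,
     monoid.mult = (\<lambda>a b. \<lambda>g\<in>carrier G.
       \<Oplus>\<^bsub>k\<^esub>h\<in>carrier G. a h \<otimes>\<^bsub>k\<^esub> b (inv\<^bsub>G\<^esub> h \<otimes>\<^bsub>G\<^esub> g)),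
     one = (\<lambda>g\<in>carrier G. if g = \<one>\<^bsub>G\<^esub> then \<one>\<^bsub>k\<^esub> else \<zero>\<^bsub>k\<^esub>),
     ring.zero = (\<lambda>g\<in>carrier G. \<zero>\<^bsub>k\<^esub>),
     ring.add = (\<lambda>a b. \<lambda>g\<in>carrier G. a g \<oplus>\<^bsub>k\<^esub> b g),
     smult = (\<lambda>c a. \<lambda>g\<in>carrier G. c \<otimes>\<^bsub>k\<^esub> a g)\<rparr>"

text \<open>The library's \<open>ord\<close> is \<open>0\<close> on elements of infinite order, as required in characteristic \<open>0\<close>.\<close>

definition characteristic :: "('k, 'n) ring_scheme \<Rightarrow> nat"
  where "characteristic R = group.ord (add_monoid R) \<one>\<^bsub>R\<^esub>"


section \<open>Centralizers, Frattini subgroups and transfer\<close>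

definition centralizer :: "('g, 'm) monoid_scheme \<Rightarrow> 'g \<Rightarrow> 'g set"
  where "centralizer G x = {g \<in> carrier G. g \<otimes>\<^bsub>G\<^esub> x = x \<otimes>\<^bsub>G\<^esub> g}"

definition maximal_subgroup :: "'g set \<Rightarrow> ('g, 'm) monoid_scheme \<Rightarrow> bool"
  where "maximal_subgroup M G \<longleftrightarrow> subgroup M G \<and> M \<noteq> carrier G \<and>
    (\<forall>K. subgroup K G \<and> M \<subset> K \<longrightarrow> K = carrier G)"

text \<open>
  Intersecting with the carrier makes the Frattini subgroup of the trivial group the group itself.
\<close>

definition frattini :: "('g, 'm) monoid_scheme \<Rightarrow> 'g set"
  where "frattini G = carrier G \<inter> \<Inter>{M. maximal_subgroup M G}"

definition abelianization :: "('g, 'm) monoid_scheme \<Rightarrow> 'g set \<Rightarrow> 'g set monoid"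
  where "abelianization G H = G\<lparr>carrier := H\<rparr> Mod derived G H"

definition right_transversal :: "('g, 'm) monoid_scheme \<Rightarrow> 'g set \<Rightarrow> 'g set \<Rightarrow> bool"
  where "right_transversal G H T \<longleftrightarrow> T \<subseteq> carrier G \<and>
    (\<forall>C \<in> rcosets\<^bsub>G\<^esub> H. \<exists>!t. t \<in> T \<and> t \<in> C)"

text \<open>The element \<open>h \<in> H\<close> with \<open>t g = h s\<close> for some \<open>s\<close> in the transversal \<open>T\<close>.\<close>

definition transfer_factor ::
  "('g, 'm) monoid_scheme \<Rightarrow> 'g set \<Rightarrow> 'g set \<Rightarrow> 'g \<Rightarrow> 'g \<Rightarrow> 'g"
  where "transfer_factor G H T g t =
    (THE h. h \<in> H \<and> (\<exists>s\<in>T. t \<otimes>\<^bsub>G\<^esub> g = h \<otimes>\<^bsub>G\<^esub> s))"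

text \<open>
  The product is formed in the abelian group \<open>H/H'\<close>, where no ordering of the transversal is
  needed; the result does not depend on the chosen transversal.
\<close>

definition transfer :: "('g, 'm) monoid_scheme \<Rightarrow> 'g set \<Rightarrow> 'g \<Rightarrow> 'g set"
  where "transfer G H g =
    (let T = SOME T. right_transversal G H T
     in \<Otimes>\<^bsub>abelianization G H\<^esub>t\<in>T. derived G H #>\<^bsub>G\<^esub> transfer_factor G H T g t)"


section \<open>The directed graphs\<close>

definition Gamma :: "('g, 'm) monoid_scheme \<Rightarrow> 'g set pair_pre_digraph"
  where "Gamma P =
    \<lparr>pverts = carrier (P Mod frattini P),
     parcs = {(frattini P #>\<^bsub>P\<^esub> x, frattini P #>\<^bsub>P\<^esub> y) | x y.
       x \<in> carrier P \<and> y \<in> carrier P \<and>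
       transfer P (centralizer P x) y \<notin> frattini (abelianization P (centralizer P x))}\<rparr>"

definition Gamma2 :: "('g, 'm) monoid_scheme \<Rightarrow> 'g set pair_pre_digraph"
  where "Gamma2 P =
    \<lparr>pverts = carrier (P Mod frattini P),
     parcs = {(a, b). a \<in> carrier (P Mod frattini P) \<and> b \<in> carrier (P Mod frattini P) \<and>
       (a, b) \<in> parcs (Gamma P) \<and> (a, a \<otimes>\<^bsub>P Mod frattini P\<^esub> b) \<in> parcs (Gamma P)}\<rparr>"

end

theory Submission
  imports Defs "Jordan_Normal_Form.Missing_Ring"
begin

text \<open>
  Let \<open>V\<close> be the largest elementary abelian \<open>2\<close>-quotient of \<open>P\<close>. A derivation \<open>D\<close> of \<open>kP\<close> sends
  \<open>g\<close> to \<open>\<phi>(g) g\<close> for a map \<open>\<phi>\<close> with \<open>\<phi>(g h) = \<phi>(g) + g \<phi>(h) g\<^sup>-\<^sup>1\<close>. If \<open>\<phi>\<close> is supported on the conjugacy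
  class of \<open>x\<close>, then modulo the kernel of \<open>kP \<rightarrow> kV\<close> it becomes \<open>\<alpha>(g) x\<close> for a homomorphism \<open>\<alpha>\<close>
  from \<open>P\<close> to the additive group of \<open>k\<close>, so that \<open>D\<close> induces the operator \<open>g \<mapsto> \<alpha>(g) x g\<close> on \<open>kV\<close>. The
  pair \<open>(x, \<alpha>)\<close> is called the symbol of \<open>D\<close>. Inner derivations induce \<open>0\<close>, because \<open>kV\<close> is commutative,
  and a computation in characteristic \<open>2\<close> shows that the bracket of derivations with symbols
  \<open>(a, \<alpha>)\<close> and \<open>(b, \<beta>)\<close> has the symbol \<open>(a b, \<alpha>(b) \<beta> + \<beta>(a) \<alpha>)\<close> (\<open>has_symbol_bracket\<close>).

  The graphs record which symbols occur. A homomorphism \<open>f\<close> from \<open>C\<^sub>P(x)\<close> to the two-element group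
  gives a derivation supported on the class of \<open>x\<close> whose symbol is \<open>(x, f \<circ> tr)\<close>, where \<open>tr\<close> is the
  transfer to \<open>C\<^sub>P(x)\<close>; and \<open>tr(y)\<close> lies outside the Frattini subgroup exactly if some \<open>f\<close> is nonzero
  on it. So an edge \<open>a \<rightarrow> b\<close> yields a symbol \<open>(a, \<alpha>)\<close> with \<open>\<alpha>(b) = 1\<close> (\<open>cocycle_of_transfer\<close>). An edge
  of \<open>\<Gamma>\<^sub>2(P)\<close> yields symbols \<open>(a, \<alpha>)\<close> with \<open>\<alpha>(b) = 1\<close> and \<open>(a, \<alpha>')\<close> with \<open>\<alpha>'(a b) = 1\<close>. As a vector space
  is not the union of two proper subspaces, one of \<open>\<alpha>\<close>, \<open>\<alpha>'\<close>, \<open>\<alpha> + \<alpha>'\<close> takes the value \<open>1\<close> at both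
  \<open>b\<close> and \<open>a b\<close>; it vanishes at \<open>a\<close> (\<open>Gamma2_edge_derivation\<close>).

  Let \<open>D\<close> have such a symbol \<open>(u, \<alpha>)\<close> for an edge from \<open>u\<close> to \<open>v\<close>, and let \<open>E\<close> have a symbol \<open>(v, \<beta>)\<close>.
  Then \<open>[D, [D, E]]\<close> has again the symbol \<open>(v, \<beta>)\<close>: on the two components \<open>v\<close> and \<open>u v\<close>, the square
  of the adjoint map of \<open>D\<close> is multiplication by \<open>\<alpha>(v) \<alpha>(u v) = 1\<close>. On a cycle every vertex \<open>v\<close> has a
  predecessor, so all symbols at vertices of the cycle survive in every term of the derived series
  (\<open>not_solvable_if_predecessors\<close>). Among them are symbols \<open>(u, \<alpha>)\<close> with \<open>\<alpha> \<noteq> 0\<close>, which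
  only nonzero classes have, so no term of the series vanishes.
\<close>

section \<open>Maximal subgroups of abelian 2-groups\<close>

text \<open>
  The elements with square in \<open>M\<close> form a subgroup containing \<open>M\<close>. If it were only \<open>M\<close>, then square
  roots of elements of \<open>M\<close> would lie in \<open>M\<close>, and starting from \<open>a\<^sup>|\<^sup>G\<^sup>| = 1\<close> with \<open>|G|\<close> a power of two
  all of \<open>G\<close> would lie in \<open>M\<close>.
\<close>
lemma (in comm_group) square_in_maximal_subgroup:
  assumes M: "maximal_subgroup M G" and ord: "order G = 2 ^ n" and x: "x \<in> carrier G"
  shows "x \<otimes> x \<in> M"
proof -
  interpret M: subgroup M G using M by (simp add: maximal_subgroup_def)
  define K where "K = {a \<in> carrier G. a \<otimes> a \<in> M}"
  have K: "subgroup K G"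
  proof (rule subgroupI)
    fix a b assume "a \<in> K" "b \<in> K"
    then have "a \<in> carrier G" "b \<in> carrier G" "(a \<otimes> a) \<otimes> (b \<otimes> b) \<in> M"
      by (auto simp: K_def)
    then show "a \<otimes> b \<in> K" by (simp add: K_def m_ac)
  next
    fix a assume "a \<in> K"
    then have "a \<in> carrier G" "inv (a \<otimes> a) \<in> M" by (auto simp: K_def)
    then show "inv a \<in> K" by (simp add: K_def inv_mult)
  next
    have "\<one> \<in> K" by (simp add: K_def)
    then show "K \<noteq> {}" by blast
  qed (auto simp: K_def)
  have "K = carrier G"
  proof (rule ccontr)
    assume "K \<noteq> carrier G"
    moreover have "M \<subseteq> K" by (auto simp: K_def)
    ultimately have "K = M" using M K by (auto simp: maximal_subgroup_def)
    then have root: "a \<in> M" if "a \<in> carrier G" "a \<otimes> a \<in> M" for a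
      using that by (auto simp: K_def)
    have "a \<in> M" if "a \<in> carrier G" "a [^] (2 ^ i :: nat) \<in> M" for a i
      using that
    proof (induction i)
      case (Suc i)
      have "a [^] (2 ^ i :: nat) \<otimes> a [^] (2 ^ i :: nat) = a [^] (2 ^ Suc i :: nat)"
        using Suc.prems(1) by (simp add: nat_pow_mult mult_2)
      then have "a [^] (2 ^ i :: nat) \<in> M" using root[of "a [^] (2 ^ i :: nat)"] Suc.prems by simp
      then show ?case by (rule Suc.IH[OF Suc.prems(1)])
    qed simp
    moreover have "a [^] (2 ^ n :: nat) \<in> M" if "a \<in> carrier G" for a
      using pow_order_eq_1[OF that] ord M.one_closed by simp
    ultimately have "carrier G \<subseteq> M" by blast
    then show False using M M.subset by (auto simp: maximal_subgroup_def)
  qed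
  then show ?thesis using x by (auto simp: K_def)
qed

text \<open>
  In other words, \<open>M\<close> has index two and membership in \<open>M\<close> is the kernel of a homomorphism to the
  two-element group. The point is that \<open>M \<union> x M\<close> is a subgroup, since \<open>x\<close> squares into \<open>M\<close>, and
  therefore is the whole group when \<open>x\<close> is not in \<open>M\<close>.
\<close>
lemma (in comm_group) mult_in_maximal_subgroup_iff:
  assumes M: "maximal_subgroup M G" and ord: "order G = 2 ^ n"
    and x: "x \<in> carrier G" and y: "y \<in> carrier G"
  shows "x \<otimes> y \<in> M \<longleftrightarrow> (x \<in> M \<longleftrightarrow> y \<in> M)"
proof -
  interpret M: subgroup M G using M by (simp add: maximal_subgroup_def)
  have quotient: "b \<in> M" if "a \<in> M" "a \<otimes> b \<in> M" "b \<in> carrier G" for a b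
  proof -
    have "inv a \<otimes> (a \<otimes> b) \<in> M" using that by blast
    then show ?thesis using that by (simp flip: m_assoc)
  qed
  have "x \<otimes> y \<in> M" if "x \<notin> M" "y \<notin> M"
  proof -
    define K where "K = {a \<in> carrier G. a \<in> M \<or> x \<otimes> a \<in> M}"
    have K: "subgroup K G"
    proof (rule subgroupI)
      fix a b assume a: "a \<in> K" and b: "b \<in> K"
      then have ab: "a \<in> carrier G" "b \<in> carrier G" by (auto simp: K_def)
      have "a \<otimes> b \<in> M" if "x \<otimes> a \<in> M" "x \<otimes> b \<in> M"
      proof (rule quotient)
        show "x \<otimes> x \<in> M" using square_in_maximal_subgroup[OF M ord x] .
        have "(x \<otimes> a) \<otimes> (x \<otimes> b) \<in> M" using that by blast
        then show "x \<otimes> x \<otimes> (a \<otimes> b) \<in> M" using ab x by (simp add: m_ac)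
      qed (use ab in simp)
      moreover have "x \<otimes> (a \<otimes> b) \<in> M" if "a \<in> M" "x \<otimes> b \<in> M"
      proof -
        have "a \<otimes> (x \<otimes> b) \<in> M" using that by blast
        then show ?thesis using ab x by (simp add: m_ac)
      qed
      moreover have "x \<otimes> (a \<otimes> b) \<in> M" if "x \<otimes> a \<in> M" "b \<in> M"
      proof -
        have "(x \<otimes> a) \<otimes> b \<in> M" using that by blast
        then show ?thesis using ab x by (simp add: m_ac)
      qed
      ultimately show "a \<otimes> b \<in> K" using a b by (auto simp: K_def)
    next
      fix a assume a: "a \<in> K"
      then have ac: "a \<in> carrier G" by (auto simp: K_def)
      have "x \<otimes> inv a \<in> M" if "x \<otimes> a \<in> M"
      proof -
        have "inv (x \<otimes> a) \<otimes> (x \<otimes> x) \<in> M"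
          using that square_in_maximal_subgroup[OF M ord x] by blast
        then show ?thesis using ac x by (simp add: inv_mult m_ac flip: m_assoc)
      qed
      then show "inv a \<in> K" using a by (auto simp: K_def)
    next
    have "\<one> \<in> K" by (simp add: K_def)
    then show "K \<noteq> {}" by blast
  qed (auto simp: K_def)
    have "x \<in> K" using square_in_maximal_subgroup[OF M ord x] x by (simp add: K_def)
    then have "M \<subset> K" using \<open>x \<notin> M\<close> by (auto simp: K_def)
    then have "K = carrier G" using M K by (auto simp: maximal_subgroup_def)
    then show ?thesis using y \<open>y \<notin> M\<close> by (auto simp: K_def)
  qed
  moreover have "x \<in> M" if "y \<in> M" "x \<otimes> y \<in> M"
    using quotient[of y x] that x y by (simp add: m_comm)
  ultimately show ?thesis using quotient[of x y] x y by auto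
qed

section \<open>Abelianizations, transversals and transfer factors\<close>
lemma (in group) order_abelianization_power_of_two:
  assumes H: "subgroup H G" and ord: "order G = 2 ^ n"
  shows "\<exists>m. order (abelianization G H) = 2 ^ m"
proof -
  interpret H: group "G\<lparr>carrier := H\<rparr>" using subgroup_imp_group[OF H] .
  have "subgroup (derived G H) (G\<lparr>carrier := H\<rparr>)"
    using derived_subgroup_is_normal[OF H] by (simp add: normal_def)
  then have "card (rcosets\<^bsub>G\<lparr>carrier := H\<rparr>\<^esub> derived G H) * card (derived G H) = card H"
    using H.lagrange[of "derived G H"] by (simp add: order_def)
  then have "order (abelianization G H) dvd card H"
    unfolding abelianization_def FactGroup_def order_def by simp (metis dvd_triv_left)
  also have "card H dvd 2 ^ n" using lagrange[OF H] unfolding ord by (metis dvd_triv_right)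
  finally show ?thesis using divides_primepow_nat[OF two_is_prime_nat] by blast
qed

lemma (in group) right_transversal_exists:
  assumes H: "subgroup H G"
  shows "\<exists>T. right_transversal G H T"
proof -
  define T where "T = (\<lambda>C. SOME t. t \<in> C) ` (rcosets H)"
  have rep: "(SOME t. t \<in> C) \<in> C" if "C \<in> rcosets H" for C
    using subgroup.rcosets_non_empty[OF H that] by (simp add: some_in_eq)
  have disj: "C = D" if "C \<in> rcosets H" "D \<in> rcosets H" "c \<in> C" "c \<in> D" for C D c
    using rcos_disjoint[OF H] that by (auto simp: pairwise_def disjnt_def)
  have "right_transversal G H T"
    unfolding right_transversal_def
  proof (intro conjI ballI)
    show "T \<subseteq> carrier G" using rep rcosets_part_G[OF H] by (auto simp: T_def)
    fix C assume C: "C \<in> rcosets H"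
    show "\<exists>!t. t \<in> T \<and> t \<in> C"
    proof (rule ex1I)
      show "(SOME t. t \<in> C) \<in> T \<and> (SOME t. t \<in> C) \<in> C" using C rep by (simp add: T_def)
      fix t assume "t \<in> T \<and> t \<in> C"
      then obtain D where D: "D \<in> rcosets H" "t = (SOME t. t \<in> D)" "t \<in> C"
        by (auto simp: T_def)
      then have "C = D" using disj[OF C D(1)] rep[OF D(1)] by simp
      then show "t = (SOME t. t \<in> C)" using D by simp
    qed
  qed
  then show ?thesis ..
qed

lemma (in group) right_transversal_decomposition:
  assumes H: "subgroup H G" and T: "right_transversal G H T" and g: "g \<in> carrier G"
  obtains s where "s \<in> T" "g \<otimes> inv s \<in> H" and "\<And>t. t \<in> T \<Longrightarrow> g \<otimes> inv t \<in> H \<Longrightarrow> t = s"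
proof -
  have sub: "T \<subseteq> carrier G" using T by (simp add: right_transversal_def)
  have "H #> g \<in> rcosets H" using g H rcosetsI subgroup.subset by blast
  then have ex1: "\<exists>!t. t \<in> T \<and> t \<in> H #> g" using T by (simp add: right_transversal_def)
  have iff: "t \<in> H #> g \<longleftrightarrow> g \<otimes> inv t \<in> H" if "t \<in> T" for t
  proof -
    have tc: "t \<in> carrier G" using sub that by auto
    have "t \<in> H #> g \<longleftrightarrow> t \<otimes> inv g \<in> H"
      using subgroup.rcos_module[OF H is_group g tc] .
    moreover have "inv (t \<otimes> inv g) = g \<otimes> inv t" "inv (g \<otimes> inv t) = t \<otimes> inv g"
      using tc g by (simp_all add: inv_mult_group)
    ultimately show ?thesis using subgroup.m_inv_closed[OF H] by metis
  qed
  from ex1 obtain s where "s \<in> T" "s \<in> H #> g" "\<And>t. t \<in> T \<Longrightarrow> t \<in> H #> g \<Longrightarrow> t = s" by blast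
  then show thesis using iff that by blast
qed

lemma (in group) transfer_factor_eq:
  assumes H: "subgroup H G" and T: "right_transversal G H T" and g: "g \<in> carrier G"
    and t: "t \<in> T" and s: "s \<in> T" and mem: "t \<otimes> g \<otimes> inv s \<in> H"
  shows "transfer_factor G H T g t = t \<otimes> g \<otimes> inv s"
  unfolding transfer_factor_def
proof (rule the_equality)
  have sub: "T \<subseteq> carrier G" using T by (simp add: right_transversal_def)
  have tg: "t \<otimes> g \<in> carrier G" using sub t g by auto
  have sc: "s \<in> carrier G" using s sub by auto
  show "t \<otimes> g \<otimes> inv s \<in> H \<and> (\<exists>s'\<in>T. t \<otimes> g = t \<otimes> g \<otimes> inv s \<otimes> s')"
    using mem s tg sc by (auto simp: m_assoc intro!: bexI[of _ s])
  fix h assume "h \<in> H \<and> (\<exists>s'\<in>T. t \<otimes> g = h \<otimes> s')"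
  then obtain s' where h: "h \<in> H" "s' \<in> T" "t \<otimes> g = h \<otimes> s'" by blast
  have hc: "h \<in> carrier G" "s' \<in> carrier G" using h sub H subgroup.subset by auto
  then have h_eq: "h = t \<otimes> g \<otimes> inv s'" using h(3) by (simp add: m_assoc)
  obtain r where "\<And>t'. t' \<in> T \<Longrightarrow> t \<otimes> g \<otimes> inv t' \<in> H \<Longrightarrow> t' = r"
    using right_transversal_decomposition[OF H T tg] by metis
  then have "s' = s" using h h_eq s mem by metis
  then show "h = t \<otimes> g \<otimes> inv s" using h_eq by simp
qed

section \<open>The group algebra in characteristic two\<close>
locale char2_group_algebra = group P + k: field k
  for P :: "('g, 'm) monoid_scheme" (structure) and k :: "('k, 'n) ring_scheme" +
  assumes finite_P: "finite (carrier P)"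
    and two_eq_zero: "\<one>\<^bsub>k\<^esub> \<oplus>\<^bsub>k\<^esub> \<one>\<^bsub>k\<^esub> = \<zero>\<^bsub>k\<^esub>"
begin

abbreviation kP :: "('k, 'g \<Rightarrow> 'k) module"
  where "kP \<equiv> group_algebra k P"

lemma double_eq_zero [simp]:
  assumes "a \<in> carrier k" shows "a \<oplus>\<^bsub>k\<^esub> a = \<zero>\<^bsub>k\<^esub>"
proof -
  have "a \<oplus>\<^bsub>k\<^esub> a = a \<otimes>\<^bsub>k\<^esub> (\<one>\<^bsub>k\<^esub> \<oplus>\<^bsub>k\<^esub> \<one>\<^bsub>k\<^esub>)" using assms by (simp only: k.r_distr k.one_closed k.r_one)
  then show ?thesis using assms by (simp add: two_eq_zero)
qed

lemma double_cancel [simp]: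
  assumes "a \<in> carrier k" "b \<in> carrier k" shows "a \<oplus>\<^bsub>k\<^esub> (a \<oplus>\<^bsub>k\<^esub> b) = b"
  using assms by (simp flip: k.a_assoc)

lemma inv_cancel [simp]:
  assumes "x \<in> carrier P" "y \<in> carrier P"
  shows "inv x \<otimes> (x \<otimes> y) = y" "x \<otimes> (inv x \<otimes> y) = y"
  using assms by (simp_all flip: m_assoc)

lemma finsum_k_closed [simp, intro]:
  "(\<And>g. g \<in> S \<Longrightarrow> f g \<in> carrier k) \<Longrightarrow> finsum k f S \<in> carrier k"
  by (rule k.finsum_closed) auto

lemma finsum_permute:
  assumes "bij_betw h (carrier P) (carrier P)" "\<And>g. g \<in> carrier P \<Longrightarrow> f g \<in> carrier k"
  shows "(\<Oplus>\<^bsub>k\<^esub>g\<in>carrier P. f (h g)) = (\<Oplus>\<^bsub>k\<^esub>g\<in>carrier P. f g)"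
proof -
  have "(\<Oplus>\<^bsub>k\<^esub>g\<in>h ` carrier P. f g) = (\<Oplus>\<^bsub>k\<^esub>g\<in>carrier P. f (h g))"
    by (rule k.finsum_reindex) (use assms in \<open>auto simp: bij_betw_def\<close>)
  then show ?thesis using assms(1) by (simp add: bij_betw_def)
qed

lemma bij_left: "c \<in> carrier P \<Longrightarrow> bij_betw (\<lambda>g. c \<otimes> g) (carrier P) (carrier P)"
  by (rule bij_betw_byWitness[where f' = "\<lambda>g. inv c \<otimes> g"]) auto

lemma bij_right: "c \<in> carrier P \<Longrightarrow> bij_betw (\<lambda>g. g \<otimes> c) (carrier P) (carrier P)"
  by (rule bij_betw_byWitness[where f' = "\<lambda>g. g \<otimes> inv c"]) (auto simp: m_assoc)

lemma bij_conj: "c \<in> carrier P \<Longrightarrow> bij_betw (\<lambda>g. inv c \<otimes> g \<otimes> c) (carrier P) (carrier P)"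
  by (rule bij_betw_byWitness[where f' = "\<lambda>g. c \<otimes> g \<otimes> inv c"]) (auto simp: m_assoc)

lemma bij_div: "c \<in> carrier P \<Longrightarrow> bij_betw (\<lambda>g. c \<otimes> inv g) (carrier P) (carrier P)"
  by (rule bij_betw_byWitness[where f' = "\<lambda>g. inv g \<otimes> c"])
    (auto simp: m_assoc inv_mult_group)

lemma finsum_swap:
  assumes "\<And>g h. g \<in> carrier P \<Longrightarrow> h \<in> carrier P \<Longrightarrow> f g h \<in> carrier k"
  shows "(\<Oplus>\<^bsub>k\<^esub>g\<in>carrier P. \<Oplus>\<^bsub>k\<^esub>h\<in>carrier P. f g h) = (\<Oplus>\<^bsub>k\<^esub>h\<in>carrier P. \<Oplus>\<^bsub>k\<^esub>g\<in>carrier P. f g h)"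
  using k.finsum_finsum_swap[OF finite_P finite_P, of f] assms by simp

lemma finsum_k_cong:
  assumes "\<And>g. g \<in> S \<Longrightarrow> f g = f' g" "\<And>g. g \<in> S \<Longrightarrow> f' g \<in> carrier k"
  shows "finsum k f S = finsum k f' S"
  by (rule k.finsum_cong') (use assms in auto)

lemma finsum_mult_left:
  assumes "a \<in> carrier k" "\<And>g. g \<in> carrier P \<Longrightarrow> f g \<in> carrier k"
  shows "a \<otimes>\<^bsub>k\<^esub> (\<Oplus>\<^bsub>k\<^esub>g\<in>carrier P. f g) = (\<Oplus>\<^bsub>k\<^esub>g\<in>carrier P. a \<otimes>\<^bsub>k\<^esub> f g)"
  by (rule k.finsum_rdistr) (use assms finite_P in auto)

lemma finsum_mult_right:
  assumes "a \<in> carrier k" "\<And>g. g \<in> carrier P \<Longrightarrow> f g \<in> carrier k"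
  shows "(\<Oplus>\<^bsub>k\<^esub>g\<in>carrier P. f g) \<otimes>\<^bsub>k\<^esub> a = (\<Oplus>\<^bsub>k\<^esub>g\<in>carrier P. f g \<otimes>\<^bsub>k\<^esub> a)"
  by (rule k.finsum_ldistr) (use assms finite_P in auto)

lemma finsum_k_add:
  assumes "\<And>g. g \<in> S \<Longrightarrow> f g \<in> carrier k" "\<And>g. g \<in> S \<Longrightarrow> f' g \<in> carrier k"
  shows "(\<Oplus>\<^bsub>k\<^esub>g\<in>S. f g \<oplus>\<^bsub>k\<^esub> f' g) = (\<Oplus>\<^bsub>k\<^esub>g\<in>S. f g) \<oplus>\<^bsub>k\<^esub> (\<Oplus>\<^bsub>k\<^esub>g\<in>S. f' g)"
  by (rule k.finsum_addf) (use assms in auto)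

lemma carrier_kP: "carrier kP = carrier P \<rightarrow>\<^sub>E carrier k"
  by (simp add: group_algebra_def)

lemma kP_coeff [simp]: "z \<in> carrier kP \<Longrightarrow> g \<in> carrier P \<Longrightarrow> z g \<in> carrier k"
  by (auto simp: carrier_kP)

lemma kP_eqI:
  "x \<in> carrier kP \<Longrightarrow> y \<in> carrier kP \<Longrightarrow> (\<And>g. g \<in> carrier P \<Longrightarrow> x g = y g) \<Longrightarrow> x = y"
  by (auto simp: carrier_kP intro: PiE_ext)

lemma kP_closed [simp, intro]:
  assumes "x \<in> carrier kP" "y \<in> carrier kP"
  shows "x \<oplus>\<^bsub>kP\<^esub> y \<in> carrier kP" "x \<otimes>\<^bsub>kP\<^esub> y \<in> carrier kP"
  using assms by (auto simp: group_algebra_def intro!: finsum_k_closed k.m_closed)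

lemma kP_smult_closed [simp, intro]:
  "c \<in> carrier k \<Longrightarrow> x \<in> carrier kP \<Longrightarrow> c \<odot>\<^bsub>kP\<^esub> x \<in> carrier kP"
  by (auto simp: group_algebra_def)

lemma kP_add: "g \<in> carrier P \<Longrightarrow> (x \<oplus>\<^bsub>kP\<^esub> y) g = x g \<oplus>\<^bsub>k\<^esub> y g"
  and kP_smult: "g \<in> carrier P \<Longrightarrow> (c \<odot>\<^bsub>kP\<^esub> x) g = c \<otimes>\<^bsub>k\<^esub> x g"
  and kP_mult: "g \<in> carrier P \<Longrightarrow>
    (x \<otimes>\<^bsub>kP\<^esub> y) g = (\<Oplus>\<^bsub>k\<^esub>h\<in>carrier P. x h \<otimes>\<^bsub>k\<^esub> y (inv h \<otimes> g))"
  by (simp_all add: group_algebra_def)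

lemma abelian_group_kP: "abelian_group kP"
proof (rule abelian_groupI)
  show "\<zero>\<^bsub>kP\<^esub> \<in> carrier kP" by (simp add: group_algebra_def)
  fix x assume x: "x \<in> carrier kP"
  then show "\<zero>\<^bsub>kP\<^esub> \<oplus>\<^bsub>kP\<^esub> x = x"
    by (intro kP_eqI) (auto simp: group_algebra_def)
  have "x \<oplus>\<^bsub>kP\<^esub> x = \<zero>\<^bsub>kP\<^esub>"
    using x by (intro kP_eqI) (auto simp: group_algebra_def)
  then show "\<exists>y\<in>carrier kP. y \<oplus>\<^bsub>kP\<^esub> x = \<zero>\<^bsub>kP\<^esub>" using x by blast
qed (auto intro!: kP_eqI simp: kP_add k.a_ac)

text \<open>
  Since \<open>kP\<close> has characteristic two, all signs in commutators and brackets disappear.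
\<close>
lemma kP_minus: 
  assumes "x \<in> carrier kP" "y \<in> carrier kP" shows "x \<ominus>\<^bsub>kP\<^esub> y = x \<oplus>\<^bsub>kP\<^esub> y"
proof -
  interpret A: abelian_group kP by (rule abelian_group_kP)
  have "y \<oplus>\<^bsub>kP\<^esub> y = \<zero>\<^bsub>kP\<^esub>"
    using assms by (intro kP_eqI) (auto simp: group_algebra_def)
  then have "\<ominus>\<^bsub>kP\<^esub> y = y" using assms by (metis A.minus_equality)
  then show ?thesis by (simp add: a_minus_def)
qed

lemma kP_distrib:
  assumes "x \<in> carrier kP" "y \<in> carrier kP" "z \<in> carrier kP"
  shows "(x \<oplus>\<^bsub>kP\<^esub> y) \<otimes>\<^bsub>kP\<^esub> z = x \<otimes>\<^bsub>kP\<^esub> z \<oplus>\<^bsub>kP\<^esub> y \<otimes>\<^bsub>kP\<^esub> z"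
    and "z \<otimes>\<^bsub>kP\<^esub> (x \<oplus>\<^bsub>kP\<^esub> y) = z \<otimes>\<^bsub>kP\<^esub> x \<oplus>\<^bsub>kP\<^esub> z \<otimes>\<^bsub>kP\<^esub> y"
proof -
  show "(x \<oplus>\<^bsub>kP\<^esub> y) \<otimes>\<^bsub>kP\<^esub> z = x \<otimes>\<^bsub>kP\<^esub> z \<oplus>\<^bsub>kP\<^esub> y \<otimes>\<^bsub>kP\<^esub> z"
  proof (rule kP_eqI)
    fix g assume g: "g \<in> carrier P"
    have "((x \<oplus>\<^bsub>kP\<^esub> y) \<otimes>\<^bsub>kP\<^esub> z) g = (\<Oplus>\<^bsub>k\<^esub>h\<in>carrier P. x h \<otimes>\<^bsub>k\<^esub> z (inv h \<otimes> g) \<oplus>\<^bsub>k\<^esub> y h \<otimes>\<^bsub>k\<^esub> z (inv h \<otimes> g))"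
      unfolding kP_mult[OF g] by (rule finsum_k_cong) (use g assms in \<open>simp_all add: kP_add k.l_distr\<close>)
    also have "\<dots> = (x \<otimes>\<^bsub>kP\<^esub> z \<oplus>\<^bsub>kP\<^esub> y \<otimes>\<^bsub>kP\<^esub> z) g"
      unfolding kP_mult[OF g] kP_add[OF g] by (rule finsum_k_add) (use g assms in simp_all)
    finally show "((x \<oplus>\<^bsub>kP\<^esub> y) \<otimes>\<^bsub>kP\<^esub> z) g = (x \<otimes>\<^bsub>kP\<^esub> z \<oplus>\<^bsub>kP\<^esub> y \<otimes>\<^bsub>kP\<^esub> z) g" .
  qed (use assms in auto)
  show "z \<otimes>\<^bsub>kP\<^esub> (x \<oplus>\<^bsub>kP\<^esub> y) = z \<otimes>\<^bsub>kP\<^esub> x \<oplus>\<^bsub>kP\<^esub> z \<otimes>\<^bsub>kP\<^esub> y"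
  proof (rule kP_eqI)
    fix g assume g: "g \<in> carrier P"
    have "(z \<otimes>\<^bsub>kP\<^esub> (x \<oplus>\<^bsub>kP\<^esub> y)) g = (\<Oplus>\<^bsub>k\<^esub>h\<in>carrier P. z h \<otimes>\<^bsub>k\<^esub> x (inv h \<otimes> g) \<oplus>\<^bsub>k\<^esub> z h \<otimes>\<^bsub>k\<^esub> y (inv h \<otimes> g))"
      unfolding kP_mult[OF g] by (rule finsum_k_cong) (use g assms in \<open>simp_all add: kP_add k.r_distr\<close>)
    also have "\<dots> = (z \<otimes>\<^bsub>kP\<^esub> x \<oplus>\<^bsub>kP\<^esub> z \<otimes>\<^bsub>kP\<^esub> y) g"
      unfolding kP_mult[OF g] kP_add[OF g] by (rule finsum_k_add) (use g assms in simp_all)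
    finally show "(z \<otimes>\<^bsub>kP\<^esub> (x \<oplus>\<^bsub>kP\<^esub> y)) g = (z \<otimes>\<^bsub>kP\<^esub> x \<oplus>\<^bsub>kP\<^esub> z \<otimes>\<^bsub>kP\<^esub> y) g" .
  qed (use assms in auto)
qed

section \<open>Derivations of the group algebra\<close>
lemma derivationD:
  assumes "D \<in> derivations k kP"
  shows "x \<in> carrier kP \<Longrightarrow> D x \<in> carrier kP"
    and "x \<in> carrier kP \<Longrightarrow> y \<in> carrier kP \<Longrightarrow> D (x \<oplus>\<^bsub>kP\<^esub> y) = D x \<oplus>\<^bsub>kP\<^esub> D y"
    and "c \<in> carrier k \<Longrightarrow> x \<in> carrier kP \<Longrightarrow> D (c \<odot>\<^bsub>kP\<^esub> x) = c \<odot>\<^bsub>kP\<^esub> D x"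
    and "x \<in> carrier kP \<Longrightarrow> y \<in> carrier kP \<Longrightarrow>
      D (x \<otimes>\<^bsub>kP\<^esub> y) = D x \<otimes>\<^bsub>kP\<^esub> y \<oplus>\<^bsub>kP\<^esub> x \<otimes>\<^bsub>kP\<^esub> D y"
  using assms by (auto simp: derivations_def)

lemma bracket_eq:
  assumes "D \<in> carrier kP \<rightarrow> carrier kP" "E \<in> carrier kP \<rightarrow> carrier kP"
  shows "D \<otimes>\<^bsub>Der k kP\<^esub> E = (\<lambda>z\<in>carrier kP. D (E z) \<oplus>\<^bsub>kP\<^esub> E (D z))"
  unfolding Der_def using assms by (auto simp: kP_minus Pi_iff intro!: restrict_ext)

lemma bracket_derivation:
  assumes D: "D \<in> derivations k kP" and E: "E \<in> derivations k kP"
  shows "D \<otimes>\<^bsub>Der k kP\<^esub> E \<in> derivations k kP"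
proof -
  interpret A: abelian_group kP by (rule abelian_group_kP)
  note d = derivationD[OF D] and e = derivationD[OF E]
  have eq: "D \<otimes>\<^bsub>Der k kP\<^esub> E = (\<lambda>z\<in>carrier kP. D (E z) \<oplus>\<^bsub>kP\<^esub> E (D z))"
    by (rule bracket_eq) (use d e in auto)
  have smult_add: "c \<odot>\<^bsub>kP\<^esub> (x \<oplus>\<^bsub>kP\<^esub> y) = c \<odot>\<^bsub>kP\<^esub> x \<oplus>\<^bsub>kP\<^esub> c \<odot>\<^bsub>kP\<^esub> y"
    if "c \<in> carrier k" "x \<in> carrier kP" "y \<in> carrier kP" for c x y
    using that by (intro kP_eqI) (auto simp: kP_add kP_smult k.r_distr)
  have double: "x \<oplus>\<^bsub>kP\<^esub> (x \<oplus>\<^bsub>kP\<^esub> y) = y" if "x \<in> carrier kP" "y \<in> carrier kP" for x y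
    using that by (intro kP_eqI) (auto simp: kP_add)
  have leibniz: "D (E (x \<otimes>\<^bsub>kP\<^esub> y)) \<oplus>\<^bsub>kP\<^esub> E (D (x \<otimes>\<^bsub>kP\<^esub> y)) =
      (D (E x) \<oplus>\<^bsub>kP\<^esub> E (D x)) \<otimes>\<^bsub>kP\<^esub> y \<oplus>\<^bsub>kP\<^esub> x \<otimes>\<^bsub>kP\<^esub> (D (E y) \<oplus>\<^bsub>kP\<^esub> E (D y))"
    if x: "x \<in> carrier kP" and y: "y \<in> carrier kP" for x y
  proof -
    have *: "D (E (x \<otimes>\<^bsub>kP\<^esub> y)) = (D (E x) \<otimes>\<^bsub>kP\<^esub> y \<oplus>\<^bsub>kP\<^esub> E x \<otimes>\<^bsub>kP\<^esub> D y) \<oplus>\<^bsub>kP\<^esub>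
        (D x \<otimes>\<^bsub>kP\<^esub> E y \<oplus>\<^bsub>kP\<^esub> x \<otimes>\<^bsub>kP\<^esub> D (E y))"
      and **: "E (D (x \<otimes>\<^bsub>kP\<^esub> y)) = (E (D x) \<otimes>\<^bsub>kP\<^esub> y \<oplus>\<^bsub>kP\<^esub> D x \<otimes>\<^bsub>kP\<^esub> E y) \<oplus>\<^bsub>kP\<^esub>
        (E x \<otimes>\<^bsub>kP\<^esub> D y \<oplus>\<^bsub>kP\<^esub> x \<otimes>\<^bsub>kP\<^esub> E (D y))"
      using x y by (simp_all add: d e)
    show ?thesis unfolding * **
      using x y by (simp add: d e kP_distrib A.a_ac double)
  qed
  show ?thesis unfolding eq
    unfolding derivations_def
    by (auto simp: leibniz) (simp_all add: d e A.a_ac smult_add)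
qed

text \<open>
  The linear map \<open>g \<mapsto> \<phi>(g) g\<close> with \<open>\<phi>(g) = (\<Sum>w. \<psi> g w \<cdot> w)\<close>, read off coefficientwise: \<open>u\<close> occurs in
  \<open>\<phi>(g) g\<close> with the coefficient of \<open>u g\<^sup>-\<^sup>1\<close> in \<open>\<phi>(g)\<close>.
\<close>
definition deriv_of :: "('g \<Rightarrow> 'g \<Rightarrow> 'k) \<Rightarrow> ('g \<Rightarrow> 'k) \<Rightarrow> 'g \<Rightarrow> 'k"
  where "deriv_of \<psi> = (\<lambda>z\<in>carrier kP. \<lambda>u\<in>carrier P. \<Oplus>\<^bsub>k\<^esub>g\<in>carrier P. z g \<otimes>\<^bsub>k\<^esub> \<psi> g (u \<otimes> inv g))"

lemma deriv_of_coeff: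
  "z \<in> carrier kP \<Longrightarrow> u \<in> carrier P \<Longrightarrow>
    deriv_of \<psi> z u = (\<Oplus>\<^bsub>k\<^esub>g\<in>carrier P. z g \<otimes>\<^bsub>k\<^esub> \<psi> g (u \<otimes> inv g))"
  by (simp add: deriv_of_def)

text \<open>
  The hypothesis is the cocycle identity \<open>\<phi>(g h) = \<phi>(g) + g \<phi>(h) g\<^sup>-\<^sup>1\<close>, that is, the Leibniz rule for
  the product of the group elements \<open>g\<close> and \<open>h\<close>.
\<close>
lemma deriv_of_derivation:
  assumes \<psi>: "\<And>g w. g \<in> carrier P \<Longrightarrow> w \<in> carrier P \<Longrightarrow> \<psi> g w \<in> carrier k"
    and cocycle: "\<And>g h w. g \<in> carrier P \<Longrightarrow> h \<in> carrier P \<Longrightarrow> w \<in> carrier P \<Longrightarrow>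
      \<psi> (g \<otimes> h) w = \<psi> g w \<oplus>\<^bsub>k\<^esub> \<psi> h (inv g \<otimes> w \<otimes> g)"
  shows "deriv_of \<psi> \<in> derivations k kP"
proof -
  let ?D = "deriv_of \<psi>"
  have closed: "?D z \<in> carrier kP" if "z \<in> carrier kP" for z
    using that by (auto simp: deriv_of_def carrier_kP intro!: finsum_k_closed k.m_closed \<psi>)
  have add: "?D (x \<oplus>\<^bsub>kP\<^esub> y) = ?D x \<oplus>\<^bsub>kP\<^esub> ?D y" if x: "x \<in> carrier kP" and y: "y \<in> carrier kP" for x y
  proof (rule kP_eqI)
    fix u assume u: "u \<in> carrier P"
    have "?D (x \<oplus>\<^bsub>kP\<^esub> y) u = (\<Oplus>\<^bsub>k\<^esub>g\<in>carrier P. x g \<otimes>\<^bsub>k\<^esub> \<psi> g (u \<otimes> inv g) \<oplus>\<^bsub>k\<^esub> y g \<otimes>\<^bsub>k\<^esub> \<psi> g (u \<otimes> inv g))"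
      unfolding deriv_of_coeff[OF kP_closed(1)[OF x y] u]
      by (rule finsum_k_cong) (use x y u \<psi> in \<open>simp_all add: kP_add k.l_distr\<close>)
    also have "\<dots> = (?D x \<oplus>\<^bsub>kP\<^esub> ?D y) u"
      unfolding kP_add[OF u] deriv_of_coeff[OF x u] deriv_of_coeff[OF y u]
      by (rule finsum_k_add) (use x y u \<psi> in auto)
    finally show "?D (x \<oplus>\<^bsub>kP\<^esub> y) u = (?D x \<oplus>\<^bsub>kP\<^esub> ?D y) u" .
  qed (use x y closed in auto)
  have smult: "?D (c \<odot>\<^bsub>kP\<^esub> x) = c \<odot>\<^bsub>kP\<^esub> ?D x" if c: "c \<in> carrier k" and x: "x \<in> carrier kP" for c x
  proof (rule kP_eqI)
    fix u assume u: "u \<in> carrier P"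
    have "?D (c \<odot>\<^bsub>kP\<^esub> x) u = (\<Oplus>\<^bsub>k\<^esub>g\<in>carrier P. c \<otimes>\<^bsub>k\<^esub> (x g \<otimes>\<^bsub>k\<^esub> \<psi> g (u \<otimes> inv g)))"
      unfolding deriv_of_coeff[OF kP_smult_closed[OF c x] u]
      by (rule finsum_k_cong) (use x c u \<psi> in \<open>simp_all add: kP_smult k.m_assoc\<close>)
    also have "\<dots> = (c \<odot>\<^bsub>kP\<^esub> ?D x) u"
      unfolding kP_smult[OF u] deriv_of_coeff[OF x u]
      by (rule finsum_mult_left[symmetric]) (use x c u \<psi> in auto)
    finally show "?D (c \<odot>\<^bsub>kP\<^esub> x) u = (c \<odot>\<^bsub>kP\<^esub> ?D x) u" .
  qed (use c x closed in auto)
  have leibniz: "?D (y \<otimes>\<^bsub>kP\<^esub> z) = ?D y \<otimes>\<^bsub>kP\<^esub> z \<oplus>\<^bsub>kP\<^esub> y \<otimes>\<^bsub>kP\<^esub> ?D z"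
    if y: "y \<in> carrier kP" and z: "z \<in> carrier kP" for y z
  proof (rule kP_eqI)
    fix u assume u: "u \<in> carrier P"
    note [simp] = u y z \<psi> closed
    let ?S = "\<lambda>f. \<Oplus>\<^bsub>k\<^esub>g\<in>carrier P. f g"
    let ?a = "\<lambda>h h'. y h \<otimes>\<^bsub>k\<^esub> \<psi> h (u \<otimes> inv h' \<otimes> inv h) \<otimes>\<^bsub>k\<^esub> z h'"
    let ?b = "\<lambda>h h'. y h \<otimes>\<^bsub>k\<^esub> (z h' \<otimes>\<^bsub>k\<^esub> \<psi> h' (inv h \<otimes> u \<otimes> inv h'))"
    \<comment> \<open>Both sides become sums over pairs \<open>(h, h')\<close> of terms of \<open>y\<close> and \<open>z\<close>;
      the cocycle identity at \<open>h h'\<close> splits the left one.\<close>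
    have "?D (y \<otimes>\<^bsub>kP\<^esub> z) u =
        ?S (\<lambda>g. ?S (\<lambda>h. y h \<otimes>\<^bsub>k\<^esub> z (inv h \<otimes> g) \<otimes>\<^bsub>k\<^esub> \<psi> g (u \<otimes> inv g)))"
      unfolding deriv_of_coeff[OF kP_closed(2)[OF y z] u]
      by (rule finsum_k_cong) (simp_all add: kP_mult finsum_mult_right)
    also have "\<dots> = ?S (\<lambda>h. ?S (\<lambda>g. y h \<otimes>\<^bsub>k\<^esub> z (inv h \<otimes> g) \<otimes>\<^bsub>k\<^esub> \<psi> g (u \<otimes> inv g)))"
      by (rule finsum_swap) simp
    also have "\<dots> = ?S (\<lambda>h. ?S (\<lambda>h'. ?a h h' \<oplus>\<^bsub>k\<^esub> ?b h h'))"
    proof (rule finsum_k_cong)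
      fix h assume h [simp]: "h \<in> carrier P"
      have "?S (\<lambda>g. y h \<otimes>\<^bsub>k\<^esub> z (inv h \<otimes> g) \<otimes>\<^bsub>k\<^esub> \<psi> g (u \<otimes> inv g)) =
          ?S (\<lambda>h'. y h \<otimes>\<^bsub>k\<^esub> z (inv h \<otimes> (h \<otimes> h')) \<otimes>\<^bsub>k\<^esub> \<psi> (h \<otimes> h') (u \<otimes> inv (h \<otimes> h')))"
        by (rule finsum_permute[OF bij_left[OF h], symmetric]) simp
      also have "\<dots> = ?S (\<lambda>h'. ?a h h' \<oplus>\<^bsub>k\<^esub> ?b h h')"
        by (rule finsum_k_cong)
          (simp_all add: cocycle inv_mult_group m_assoc k.r_distr k.m_ac)
      finally show "?S (\<lambda>g. y h \<otimes>\<^bsub>k\<^esub> z (inv h \<otimes> g) \<otimes>\<^bsub>k\<^esub> \<psi> g (u \<otimes> inv g)) =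
        ?S (\<lambda>h'. ?a h h' \<oplus>\<^bsub>k\<^esub> ?b h h')" .
    qed auto
    also have "\<dots> = ?S (\<lambda>h. ?S (?a h) \<oplus>\<^bsub>k\<^esub> ?S (?b h))"
      by (rule finsum_k_cong) (simp_all add: finsum_k_add)
    also have "\<dots> = ?S (\<lambda>h. ?S (?a h)) \<oplus>\<^bsub>k\<^esub> ?S (\<lambda>h. ?S (?b h))"
      by (rule finsum_k_add) simp_all
    also have "?S (\<lambda>h. ?S (?b h)) = (y \<otimes>\<^bsub>kP\<^esub> ?D z) u"
      unfolding kP_mult[OF u]
      by (rule finsum_k_cong) (simp_all add: deriv_of_coeff finsum_mult_left)
    also have "?S (\<lambda>h. ?S (?a h)) = ?S (\<lambda>h'. ?S (\<lambda>h. ?a h h'))"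
      by (rule finsum_swap) simp
    also have "\<dots> = ?S (\<lambda>h'. ?D y (u \<otimes> inv h') \<otimes>\<^bsub>k\<^esub> z (inv (u \<otimes> inv h') \<otimes> u))"
      by (rule finsum_k_cong)
        (simp_all add: deriv_of_coeff finsum_mult_right inv_mult_group m_assoc)
    also have "\<dots> = (?D y \<otimes>\<^bsub>kP\<^esub> z) u"
      unfolding kP_mult[OF u] by (rule finsum_permute[OF bij_div[OF u]]) simp
    finally show "?D (y \<otimes>\<^bsub>kP\<^esub> z) u = (?D y \<otimes>\<^bsub>kP\<^esub> z \<oplus>\<^bsub>kP\<^esub> y \<otimes>\<^bsub>kP\<^esub> ?D z) u"
      by (simp add: kP_add)
  qed (use y z closed in auto)
  show ?thesis
    unfolding derivations_def using closed add smult leibniz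
    by (auto simp: deriv_of_def)
qed

section \<open>Homomorphisms to the two-element group\<close>

text \<open>
  The two-element group is realised as the prime field inside \<open>k\<close>, so that its elements can serve
  as coefficients.
\<close>
abbreviation bits :: "'k set" where "bits \<equiv> {\<zero>\<^bsub>k\<^esub>, \<one>\<^bsub>k\<^esub>}"

lemma bits_closed: "a \<in> bits \<Longrightarrow> a \<in> carrier k"
  by auto

lemma bits_add: "a \<in> bits \<Longrightarrow> b \<in> bits \<Longrightarrow> a \<oplus>\<^bsub>k\<^esub> b \<in> bits"
  by (auto simp: two_eq_zero)

lemma finsum_bits:
  assumes "finite S" "\<And>g. g \<in> S \<Longrightarrow> f g \<in> bits" shows "finsum k f S \<in> bits"
  using assms
proof (induction S)
  case (insert s S)
  have "finsum k f (insert s S) = f s \<oplus>\<^bsub>k\<^esub> finsum k f S"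
    by (rule k.finsum_insert) (use insert in \<open>auto intro!: bits_closed simp del: insert_iff\<close>)
  moreover have "f s \<in> bits" "finsum k f S \<in> bits" using insert by blast+
  ultimately show ?case using bits_add by presburger
qed simp

definition bit_hom :: "('g \<Rightarrow> 'k) \<Rightarrow> bool"
  where "bit_hom \<alpha> \<longleftrightarrow> (\<forall>g\<in>carrier P. \<alpha> g \<in> bits) \<and>
    (\<forall>g\<in>carrier P. \<forall>h\<in>carrier P. \<alpha> (g \<otimes> h) = \<alpha> g \<oplus>\<^bsub>k\<^esub> \<alpha> h)"

lemma bit_hom_bits: "bit_hom \<alpha> \<Longrightarrow> g \<in> carrier P \<Longrightarrow> \<alpha> g \<in> bits"
  and bit_hom_closed [simp]: "bit_hom \<alpha> \<Longrightarrow> g \<in> carrier P \<Longrightarrow> \<alpha> g \<in> carrier k"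
  and bit_hom_mult: "bit_hom \<alpha> \<Longrightarrow> g \<in> carrier P \<Longrightarrow> h \<in> carrier P \<Longrightarrow> \<alpha> (g \<otimes> h) = \<alpha> g \<oplus>\<^bsub>k\<^esub> \<alpha> h"
  by (simp_all add: bit_hom_def bits_closed del: insert_iff)

lemma bit_hom_one: assumes "bit_hom \<alpha>" shows "\<alpha> \<one> = \<zero>\<^bsub>k\<^esub>"
proof -
  have "\<alpha> \<one> = \<alpha> \<one> \<oplus>\<^bsub>k\<^esub> \<alpha> \<one>" using bit_hom_mult[OF assms, of \<one> \<one>] by simp
  also have "\<dots> = \<zero>\<^bsub>k\<^esub>" using assms by simp
  finally show ?thesis .
qed

lemma bit_hom_inv: assumes "bit_hom \<alpha>" "g \<in> carrier P" shows "\<alpha> (inv g) = \<alpha> g"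
proof -
  have "\<alpha> g \<oplus>\<^bsub>k\<^esub> (\<alpha> g \<oplus>\<^bsub>k\<^esub> \<alpha> (inv g)) = \<alpha> g \<oplus>\<^bsub>k\<^esub> \<zero>\<^bsub>k\<^esub>"
    using bit_hom_mult[OF assms(1), of g "inv g"] assms by (simp add: bit_hom_one)
  then show ?thesis using assms by simp
qed

lemma bit_hom_add:
  assumes "bit_hom \<alpha>" "bit_hom \<beta>" shows "bit_hom (\<lambda>g. \<alpha> g \<oplus>\<^bsub>k\<^esub> \<beta> g)"
  unfolding bit_hom_def
proof (intro conjI ballI)
  show "\<alpha> g \<oplus>\<^bsub>k\<^esub> \<beta> g \<in> bits" if "g \<in> carrier P" for g
    using bit_hom_bits[OF assms(1) that] bit_hom_bits[OF assms(2) that] by (rule bits_add)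
qed (use assms in \<open>simp add: bit_hom_mult k.a_ac\<close>)

lemma bit_hom_bracket:
  assumes "bit_hom \<alpha>" "bit_hom \<beta>" "c \<in> bits" "d \<in> bits"
  shows "bit_hom (\<lambda>g. c \<otimes>\<^bsub>k\<^esub> \<beta> g \<oplus>\<^bsub>k\<^esub> d \<otimes>\<^bsub>k\<^esub> \<alpha> g)"
proof -
  have "bit_hom (\<lambda>g. c \<otimes>\<^bsub>k\<^esub> \<kappa> g)" if "c \<in> bits" "bit_hom \<kappa>" for c \<kappa>
    using that bit_hom_bits[of \<kappa>] by (auto simp: bit_hom_def k.r_distr)
  then show ?thesis using assms by (intro bit_hom_add) blast+
qed

text \<open>
  The kernel is the whole group or has index two, and a subgroup of index two is maximal.
\<close>
lemma frattini_bit_hom: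
  assumes \<alpha>: "bit_hom \<alpha>" and n: "n \<in> frattini P"
  shows "\<alpha> n = \<zero>\<^bsub>k\<^esub>"
proof -
  define M where "M = {g \<in> carrier P. \<alpha> g = \<zero>\<^bsub>k\<^esub>}"
  have nc: "n \<in> carrier P" using n by (simp add: frattini_def)
  have M: "subgroup M P"
  proof (intro subgroupI)
    have "\<one> \<in> M" using \<alpha> by (simp add: M_def bit_hom_one)
    then show "M \<noteq> {}" by blast
  next
    show "a \<otimes> b \<in> M" if "a \<in> M" "b \<in> M" for a b
      using that \<alpha> by (simp add: M_def bit_hom_mult)
    show "inv a \<in> M" if "a \<in> M" for a
      using that \<alpha> by (simp add: M_def bit_hom_inv)
  qed (auto simp: M_def)
  have "maximal_subgroup M P" if "M \<noteq> carrier P"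
    unfolding maximal_subgroup_def
  proof (intro conjI allI impI M that)
    fix K assume K: "subgroup K P \<and> M \<subset> K"
    interpret K: subgroup K P using K by simp
    obtain g where g: "g \<in> K" "g \<notin> M" using K by blast
    then have \<alpha>g: "\<alpha> g = \<one>\<^bsub>k\<^esub>" using bit_hom_bits[OF \<alpha>, of g] by (auto simp: M_def)
    show "K = carrier P"
    proof (rule antisym)
      show "carrier P \<subseteq> K"
      proof
        fix h assume h: "h \<in> carrier P"
        show "h \<in> K"
        proof (cases "\<alpha> h = \<zero>\<^bsub>k\<^esub>")
          case True then show ?thesis using h K by (auto simp: M_def)
        next
          case False
          then have "\<alpha> h = \<one>\<^bsub>k\<^esub>" using bit_hom_bits[OF \<alpha> h] by auto
          then have "g \<otimes> h \<in> M" using \<alpha> g h \<alpha>g by (simp add: M_def bit_hom_mult)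
          then have "inv g \<otimes> (g \<otimes> h) \<in> K" using K g by blast
          then show ?thesis using g h by simp
        qed
      qed
    qed (use K.subset in blast)
  qed
  then have "n \<in> M" using n nc by (cases "M = carrier P") (auto simp: frattini_def)
  then show ?thesis by (simp add: M_def)
qed

text \<open>
  Equality in the largest elementary abelian \<open>2\<close>-quotient \<open>V\<close> of \<open>P\<close>. Phrasing it by homomorphisms
  makes commutativity and the vanishing of squares immediate.
\<close>
definition bit_equiv :: "'g \<Rightarrow> 'g \<Rightarrow> bool"
  where "bit_equiv x y \<longleftrightarrow> (\<forall>\<alpha>. bit_hom \<alpha> \<longrightarrow> \<alpha> x = \<alpha> y)"

lemma frattini_subset: "frattini P \<subseteq> carrier P"
  by (auto simp: frattini_def)

lemma bit_equiv_frattini_coset: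
  assumes "x \<in> frattini P #> y" "y \<in> carrier P"
  shows "bit_equiv x y"
  using assms frattini_subset
  by (auto simp: r_coset_def bit_equiv_def bit_hom_mult frattini_bit_hom subset_iff)

section \<open>Symbols of operators on the group algebra\<close>

text \<open>
  These functions are the linear functionals on \<open>kV\<close>. An element of \<open>kP\<close> is studied modulo the kernel
  of \<open>kP \<rightarrow> kV\<close> through its pairings with them, which avoids forming \<open>kV\<close> itself.
\<close>
definition invariant_functions :: "('g \<Rightarrow> 'k) set"
  where "invariant_functions = {q \<in> carrier P \<rightarrow> carrier k.
    \<forall>x\<in>carrier P. \<forall>y\<in>carrier P. bit_equiv x y \<longrightarrow> q x = q y}"

lemma invariant_closed [simp]: "q \<in> invariant_functions \<Longrightarrow> g \<in> carrier P \<Longrightarrow> q g \<in> carrier k"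
  by (auto simp: invariant_functions_def)

lemma invariantD:
  "q \<in> invariant_functions \<Longrightarrow> x \<in> carrier P \<Longrightarrow> y \<in> carrier P \<Longrightarrow> bit_equiv x y \<Longrightarrow> q x = q y"
  unfolding invariant_functions_def by blast

lemma bit_equiv_mult:
  assumes "bit_equiv x x'" "bit_equiv y y'"
    and "x \<in> carrier P" "x' \<in> carrier P" "y \<in> carrier P" "y' \<in> carrier P"
  shows "bit_equiv (x \<otimes> y) (x' \<otimes> y')"
  using assms(1,2) unfolding bit_equiv_def by (metis assms(3-6) bit_hom_mult)

lemma bit_equiv_commute:
  "x \<in> carrier P \<Longrightarrow> y \<in> carrier P \<Longrightarrow> bit_equiv (x \<otimes> y) (y \<otimes> x)"
  by (simp add: bit_equiv_def bit_hom_mult k.a_comm)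

lemma bit_equiv_refl [simp]: "bit_equiv x x"
  by (simp add: bit_equiv_def)

definition pairing :: "('g \<Rightarrow> 'k) \<Rightarrow> ('g \<Rightarrow> 'k) \<Rightarrow> 'k"
  where "pairing q z = (\<Oplus>\<^bsub>k\<^esub>g\<in>carrier P. q g \<otimes>\<^bsub>k\<^esub> z g)"

text \<open>The transpose of the operator \<open>g \<mapsto> \<alpha>(g) a g\<close> on \<open>kV\<close>.\<close>
definition pullback :: "'g \<Rightarrow> ('g \<Rightarrow> 'k) \<Rightarrow> ('g \<Rightarrow> 'k) \<Rightarrow> 'g \<Rightarrow> 'k"
  where "pullback a \<alpha> q = (\<lambda>g. q (a \<otimes> g) \<otimes>\<^bsub>k\<^esub> \<alpha> g)"

lemma pullback_invariant [simp]:
  assumes "a \<in> carrier P" "bit_hom \<alpha>" "q \<in> invariant_functions"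
  shows "pullback a \<alpha> q \<in> invariant_functions"
proof -
  have "pullback a \<alpha> q x = pullback a \<alpha> q y"
    if x: "x \<in> carrier P" and y: "y \<in> carrier P" and xy: "bit_equiv x y" for x y
  proof -
    have "q (a \<otimes> x) = q (a \<otimes> y)"
      by (rule invariantD[OF assms(3)]) (use assms x y xy in \<open>simp_all add: bit_equiv_mult\<close>)
    moreover have "\<alpha> x = \<alpha> y" using xy assms(2) unfolding bit_equiv_def by blast
    ultimately show ?thesis by (simp only: pullback_def)
  qed
  moreover have "pullback a \<alpha> q \<in> carrier P \<rightarrow> carrier k" using assms by (simp add: pullback_def)
  ultimately show ?thesis unfolding invariant_functions_def by blast
qed

lemma pairing_closed [simp]:
  "q \<in> invariant_functions \<Longrightarrow> z \<in> carrier kP \<Longrightarrow> pairing q z \<in> carrier k"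
  by (simp add: pairing_def)

lemma pairing_add:
  assumes "q \<in> invariant_functions" "z \<in> carrier kP" "w \<in> carrier kP"
  shows "pairing q (z \<oplus>\<^bsub>kP\<^esub> w) = pairing q z \<oplus>\<^bsub>k\<^esub> pairing q w"
proof -
  have "pairing q (z \<oplus>\<^bsub>kP\<^esub> w) = (\<Oplus>\<^bsub>k\<^esub>g\<in>carrier P. q g \<otimes>\<^bsub>k\<^esub> z g \<oplus>\<^bsub>k\<^esub> q g \<otimes>\<^bsub>k\<^esub> w g)"
    unfolding pairing_def by (rule finsum_k_cong) (use assms in \<open>simp_all add: kP_add k.r_distr\<close>)
  also have "\<dots> = pairing q z \<oplus>\<^bsub>k\<^esub> pairing q w"
    unfolding pairing_def by (rule finsum_k_add) (use assms in simp_all)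
  finally show ?thesis .
qed

lemma pairing_add_left:
  assumes "q \<in> invariant_functions" "r \<in> invariant_functions" "z \<in> carrier kP"
  shows "pairing (\<lambda>g. q g \<oplus>\<^bsub>k\<^esub> r g) z = pairing q z \<oplus>\<^bsub>k\<^esub> pairing r z"
proof -
  have "pairing (\<lambda>g. q g \<oplus>\<^bsub>k\<^esub> r g) z = (\<Oplus>\<^bsub>k\<^esub>g\<in>carrier P. q g \<otimes>\<^bsub>k\<^esub> z g \<oplus>\<^bsub>k\<^esub> r g \<otimes>\<^bsub>k\<^esub> z g)"
    unfolding pairing_def by (rule finsum_k_cong) (use assms in \<open>simp_all add: k.l_distr\<close>)
  also have "\<dots> = pairing q z \<oplus>\<^bsub>k\<^esub> pairing r z"
    unfolding pairing_def by (rule finsum_k_add) (use assms in simp_all)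
  finally show ?thesis .
qed

lemma pairing_cong:
  assumes "\<And>g. g \<in> carrier P \<Longrightarrow> q g = r g" "r \<in> invariant_functions" "z \<in> carrier kP"
  shows "pairing q z = pairing r z"
  unfolding pairing_def by (rule finsum_k_cong) (use assms in auto)

lemma pairing_mult:
  assumes q: "q \<in> invariant_functions" and x: "x \<in> carrier kP" and z: "z \<in> carrier kP"
  shows "pairing q (x \<otimes>\<^bsub>kP\<^esub> z) =
    (\<Oplus>\<^bsub>k\<^esub>h\<in>carrier P. \<Oplus>\<^bsub>k\<^esub>g\<in>carrier P. q (h \<otimes> g) \<otimes>\<^bsub>k\<^esub> (x h \<otimes>\<^bsub>k\<^esub> z g))"
proof -
  note [simp] = q x z
  have "pairing q (x \<otimes>\<^bsub>kP\<^esub> z) =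
      (\<Oplus>\<^bsub>k\<^esub>g\<in>carrier P. \<Oplus>\<^bsub>k\<^esub>h\<in>carrier P. q g \<otimes>\<^bsub>k\<^esub> (x h \<otimes>\<^bsub>k\<^esub> z (inv h \<otimes> g)))"
    unfolding pairing_def by (rule finsum_k_cong) (simp_all add: kP_mult finsum_mult_left)
  also have "\<dots> = (\<Oplus>\<^bsub>k\<^esub>h\<in>carrier P. \<Oplus>\<^bsub>k\<^esub>g\<in>carrier P. q g \<otimes>\<^bsub>k\<^esub> (x h \<otimes>\<^bsub>k\<^esub> z (inv h \<otimes> g)))"
    by (rule finsum_swap) simp
  also have "\<dots> = (\<Oplus>\<^bsub>k\<^esub>h\<in>carrier P. \<Oplus>\<^bsub>k\<^esub>g\<in>carrier P. q (h \<otimes> g) \<otimes>\<^bsub>k\<^esub> (x h \<otimes>\<^bsub>k\<^esub> z g))"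
  proof (rule finsum_k_cong)
    fix h assume h [simp]: "h \<in> carrier P"
    have "(\<Oplus>\<^bsub>k\<^esub>g\<in>carrier P. q g \<otimes>\<^bsub>k\<^esub> (x h \<otimes>\<^bsub>k\<^esub> z (inv h \<otimes> g))) =
        (\<Oplus>\<^bsub>k\<^esub>g\<in>carrier P. q (h \<otimes> g) \<otimes>\<^bsub>k\<^esub> (x h \<otimes>\<^bsub>k\<^esub> z (inv h \<otimes> (h \<otimes> g))))"
      by (rule finsum_permute[OF bij_left[OF h], symmetric]) simp
    also have "\<dots> = (\<Oplus>\<^bsub>k\<^esub>g\<in>carrier P. q (h \<otimes> g) \<otimes>\<^bsub>k\<^esub> (x h \<otimes>\<^bsub>k\<^esub> z g))"
      by (rule finsum_k_cong) simp_all
    finally show "(\<Oplus>\<^bsub>k\<^esub>g\<in>carrier P. q g \<otimes>\<^bsub>k\<^esub> (x h \<otimes>\<^bsub>k\<^esub> z (inv h \<otimes> g))) =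
      (\<Oplus>\<^bsub>k\<^esub>g\<in>carrier P. q (h \<otimes> g) \<otimes>\<^bsub>k\<^esub> (x h \<otimes>\<^bsub>k\<^esub> z g))" .
  qed simp
  finally show ?thesis .
qed

text \<open>This expresses that \<open>kV\<close> is commutative.\<close>
lemma pairing_mult_commute:
  assumes q: "q \<in> invariant_functions" and x: "x \<in> carrier kP" and z: "z \<in> carrier kP"
  shows "pairing q (x \<otimes>\<^bsub>kP\<^esub> z) = pairing q (z \<otimes>\<^bsub>kP\<^esub> x)"
proof -
  have "pairing q (z \<otimes>\<^bsub>kP\<^esub> x) =
      (\<Oplus>\<^bsub>k\<^esub>h\<in>carrier P. \<Oplus>\<^bsub>k\<^esub>g\<in>carrier P. q (g \<otimes> h) \<otimes>\<^bsub>k\<^esub> (z g \<otimes>\<^bsub>k\<^esub> x h))"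
    unfolding pairing_mult[OF q z x] by (rule finsum_swap) (use assms in simp)
  also have "\<dots> = (\<Oplus>\<^bsub>k\<^esub>h\<in>carrier P. \<Oplus>\<^bsub>k\<^esub>g\<in>carrier P. q (h \<otimes> g) \<otimes>\<^bsub>k\<^esub> (x h \<otimes>\<^bsub>k\<^esub> z g))"
  proof (intro finsum_k_cong)
    fix h g assume h: "h \<in> carrier P" and g: "g \<in> carrier P"
    have "q (g \<otimes> h) = q (h \<otimes> g)"
      by (rule invariantD[OF q]) (use g h in \<open>simp_all add: bit_equiv_commute\<close>)
    then show "q (g \<otimes> h) \<otimes>\<^bsub>k\<^esub> (z g \<otimes>\<^bsub>k\<^esub> x h) = q (h \<otimes> g) \<otimes>\<^bsub>k\<^esub> (x h \<otimes>\<^bsub>k\<^esub> z g)"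
      using g h x z by (simp add: k.m_comm)
  qed (use assms in auto)
  finally show ?thesis unfolding pairing_mult[OF q x z] by simp
qed

text \<open>
  The operator \<open>D\<close> descends to \<open>kV\<close> and acts there by \<open>g \<mapsto> \<alpha>(g) a g\<close>.
\<close>
definition has_symbol :: "(('g \<Rightarrow> 'k) \<Rightarrow> 'g \<Rightarrow> 'k) \<Rightarrow> 'g \<Rightarrow> ('g \<Rightarrow> 'k) \<Rightarrow> bool"
  where "has_symbol D a \<alpha> \<longleftrightarrow> D \<in> carrier kP \<rightarrow> carrier kP \<and>
    (\<forall>q\<in>invariant_functions. \<forall>z\<in>carrier kP. pairing q (D z) = pairing (pullback a \<alpha> q) z)"

lemma has_symbol_cong:
  assumes D: "has_symbol D a \<alpha>" and "bit_equiv a b" "a \<in> carrier P" "b \<in> carrier P" "bit_hom \<alpha>" "bit_hom \<beta>"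
    and "\<And>g. g \<in> carrier P \<Longrightarrow> \<alpha> g = \<beta> g"
  shows "has_symbol D b \<beta>"
proof -
  have "pairing (pullback a \<alpha> q) z = pairing (pullback b \<beta> q) z"
    if "q \<in> invariant_functions" "z \<in> carrier kP" for q z
  proof (rule pairing_cong)
    fix g assume g: "g \<in> carrier P"
    have "q (a \<otimes> g) = q (b \<otimes> g)"
      by (rule invariantD[OF that(1)]) (use assms g bit_equiv_mult[of a b g g] in auto)
    then show "pullback a \<alpha> q g = pullback b \<beta> q g" using assms g by (simp add: pullback_def)
  qed (use assms that in simp_all)
  then show ?thesis using D by (simp add: has_symbol_def)
qed

lemma inner_derivation_pairing:
  assumes i: "i \<in> InnDer kP" and z: "z \<in> carrier kP"
  shows "i z \<in> carrier kP" and "q \<in> invariant_functions \<Longrightarrow> pairing q (i z) = \<zero>\<^bsub>k\<^esub>"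
proof -
  obtain x where x: "x \<in> carrier kP"
    and i_eq: "i = (\<lambda>z\<in>carrier kP. x \<otimes>\<^bsub>kP\<^esub> z \<ominus>\<^bsub>kP\<^esub> z \<otimes>\<^bsub>kP\<^esub> x)"
    using i by (auto simp: InnDer_def)
  have eq: "i z = x \<otimes>\<^bsub>kP\<^esub> z \<oplus>\<^bsub>kP\<^esub> z \<otimes>\<^bsub>kP\<^esub> x"
    using z x by (simp add: i_eq kP_minus)
  show "i z \<in> carrier kP" using x z by (simp add: eq)
  show "pairing q (i z) = \<zero>\<^bsub>k\<^esub>" if q: "q \<in> invariant_functions"
    using q x z by (simp add: eq pairing_add pairing_mult_commute[OF q x z])
qed

text \<open>
  The symbol depends only on the class in the first Hochschild cohomology.
\<close>
lemma has_symbol_add_inner: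
  assumes D: "has_symbol D a \<alpha>" and i: "i \<in> InnDer kP"
  shows "has_symbol (i \<oplus>\<^bsub>Der k kP\<^esub> D) a \<alpha>"
proof -
  have Dc: "D \<in> carrier kP \<rightarrow> carrier kP" using D by (simp add: has_symbol_def)
  have eq: "(i \<oplus>\<^bsub>Der k kP\<^esub> D) z = i z \<oplus>\<^bsub>kP\<^esub> D z" if "z \<in> carrier kP" for z
    using that by (simp add: Der_def)
  show ?thesis
    unfolding has_symbol_def
  proof (intro conjI ballI)
    show "i \<oplus>\<^bsub>Der k kP\<^esub> D \<in> carrier kP \<rightarrow> carrier kP"
      by (auto simp: eq funcset_mem[OF Dc] inner_derivation_pairing(1)[OF i])
    fix q z assume q: "q \<in> invariant_functions" and z: "z \<in> carrier kP"
    have "pairing q ((i \<oplus>\<^bsub>Der k kP\<^esub> D) z) = pairing q (D z)"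
      using q z inner_derivation_pairing[OF i z] by (simp add: eq pairing_add funcset_mem[OF Dc])
    then show "pairing q ((i \<oplus>\<^bsub>Der k kP\<^esub> D) z) = pairing (pullback a \<alpha> q) z"
      using D q z by (simp add: has_symbol_def)
  qed
qed

text \<open>
  The composite of \<open>D\<close> after \<open>E\<close> acts on \<open>kV\<close> by \<open>g \<mapsto> \<beta>(g) \<alpha>(b g) a b g\<close>, and \<open>\<alpha>(b g) = \<alpha>(b) + \<alpha>(g)\<close>. In
  the sum with the opposite composite the two products \<open>\<alpha>(g) \<beta>(g)\<close> cancel.
\<close>
lemma has_symbol_bracket:
  assumes D: "has_symbol D a \<alpha>" and E: "has_symbol E b \<beta>"
    and a: "a \<in> carrier P" and b: "b \<in> carrier P" and \<alpha>: "bit_hom \<alpha>" and \<beta>: "bit_hom \<beta>"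
  shows "has_symbol (D \<otimes>\<^bsub>Der k kP\<^esub> E) (a \<otimes> b) (\<lambda>g. \<alpha> b \<otimes>\<^bsub>k\<^esub> \<beta> g \<oplus>\<^bsub>k\<^esub> \<beta> a \<otimes>\<^bsub>k\<^esub> \<alpha> g)"
proof -
  have Dc: "D \<in> carrier kP \<rightarrow> carrier kP" and Ec: "E \<in> carrier kP \<rightarrow> carrier kP"
    using D E by (simp_all add: has_symbol_def)
  let ?\<nu> = "\<lambda>g. \<alpha> b \<otimes>\<^bsub>k\<^esub> \<beta> g \<oplus>\<^bsub>k\<^esub> \<beta> a \<otimes>\<^bsub>k\<^esub> \<alpha> g"
  have \<nu>: "bit_hom ?\<nu>"
    by (intro bit_hom_bracket bit_hom_bits) (use a b \<alpha> \<beta> in simp_all)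
  show ?thesis
    unfolding has_symbol_def
  proof (intro conjI ballI)
    show "D \<otimes>\<^bsub>Der k kP\<^esub> E \<in> carrier kP \<rightarrow> carrier kP"
      unfolding bracket_eq[OF Dc Ec] by (auto simp: funcset_mem[OF Dc] funcset_mem[OF Ec])
    fix q z assume q: "q \<in> invariant_functions" and z: "z \<in> carrier kP"
    have Dz: "D z \<in> carrier kP" and Ez: "E z \<in> carrier kP" using Dc Ec z by auto
    have "pairing q ((D \<otimes>\<^bsub>Der k kP\<^esub> E) z) = pairing q (D (E z)) \<oplus>\<^bsub>k\<^esub> pairing q (E (D z))"
      unfolding bracket_eq[OF Dc Ec] using q z Dz Ez Dc Ec by (simp add: pairing_add funcset_mem)
    also have "\<dots> = pairing (pullback b \<beta> (pullback a \<alpha> q)) z \<oplus>\<^bsub>k\<^esub> pairing (pullback a \<alpha> (pullback b \<beta> q)) z"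
      using D E a b \<alpha> \<beta> q z Dz Ez by (simp add: has_symbol_def)
    also have "\<dots> = pairing (\<lambda>g. pullback b \<beta> (pullback a \<alpha> q) g \<oplus>\<^bsub>k\<^esub> pullback a \<alpha> (pullback b \<beta> q) g) z"
      using a b \<alpha> \<beta> q z by (simp add: pairing_add_left)
    also have "\<dots> = pairing (pullback (a \<otimes> b) ?\<nu> q) z"
    proof (rule pairing_cong)
      fix g assume g: "g \<in> carrier P"
      have "bit_equiv (b \<otimes> (a \<otimes> g)) (a \<otimes> b \<otimes> g)"
        using bit_equiv_mult[OF bit_equiv_commute[OF b a] bit_equiv_refl[of g]] a b g
        by (simp add: m_assoc)
      then have "q (b \<otimes> (a \<otimes> g)) = q (a \<otimes> b \<otimes> g)"
        using invariantD[OF q] a b g by simp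
      moreover have "q (a \<otimes> (b \<otimes> g)) = q (a \<otimes> b \<otimes> g)" using a b g by (simp add: m_assoc)
      ultimately have "pullback b \<beta> (pullback a \<alpha> q) g \<oplus>\<^bsub>k\<^esub> pullback a \<alpha> (pullback b \<beta> q) g =
          q (a \<otimes> b \<otimes> g) \<otimes>\<^bsub>k\<^esub> ((\<alpha> b \<oplus>\<^bsub>k\<^esub> \<alpha> g) \<otimes>\<^bsub>k\<^esub> \<beta> g \<oplus>\<^bsub>k\<^esub> (\<beta> a \<oplus>\<^bsub>k\<^esub> \<beta> g) \<otimes>\<^bsub>k\<^esub> \<alpha> g)"
        using a b g \<alpha> \<beta> q by (simp add: pullback_def bit_hom_mult k.r_distr k.l_distr k.m_assoc)
      also have "(\<alpha> b \<oplus>\<^bsub>k\<^esub> \<alpha> g) \<otimes>\<^bsub>k\<^esub> \<beta> g \<oplus>\<^bsub>k\<^esub> (\<beta> a \<oplus>\<^bsub>k\<^esub> \<beta> g) \<otimes>\<^bsub>k\<^esub> \<alpha> g = ?\<nu> g"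
        using a b g \<alpha> \<beta> by (simp add: k.l_distr k.r_distr k.a_ac k.m_comm)
      finally show "pullback b \<beta> (pullback a \<alpha> q) g \<oplus>\<^bsub>k\<^esub> pullback a \<alpha> (pullback b \<beta> q) g =
          pullback (a \<otimes> b) ?\<nu> q g"
        by (simp add: pullback_def)
    qed (use a b \<nu> q z in simp_all)
    finally show "pairing q ((D \<otimes>\<^bsub>Der k kP\<^esub> E) z) = pairing (pullback (a \<otimes> b) ?\<nu> q) z" .
  qed
qed

section \<open>Derivations from cocycles\<close>

text \<open>
  The coefficients of a map \<open>\<phi>\<close> as in \<open>deriv_of\<close>, where \<open>\<phi>(g)\<close> is a sum of elements with the same
  image in \<open>V\<close> as \<open>a\<close>. Coefficients lie in the prime field so that their sum is a homomorphism to
  the two-element group.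
\<close>
definition cocycle_over :: "'g \<Rightarrow> ('g \<Rightarrow> 'g \<Rightarrow> 'k) \<Rightarrow> bool"
  where "cocycle_over a \<psi> \<longleftrightarrow>
    (\<forall>g\<in>carrier P. \<forall>w\<in>carrier P. \<psi> g w \<in> bits \<and> (\<psi> g w = \<zero>\<^bsub>k\<^esub> \<or> bit_equiv w a)) \<and>
    (\<forall>g\<in>carrier P. \<forall>h\<in>carrier P. \<forall>w\<in>carrier P.
      \<psi> (g \<otimes> h) w = \<psi> g w \<oplus>\<^bsub>k\<^esub> \<psi> h (inv g \<otimes> w \<otimes> g))"

lemma cocycle_bits: "cocycle_over a \<psi> \<Longrightarrow> g \<in> carrier P \<Longrightarrow> w \<in> carrier P \<Longrightarrow> \<psi> g w \<in> bits"
  unfolding cocycle_over_def by blast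

lemma cocycle_closed [simp]:
  "cocycle_over a \<psi> \<Longrightarrow> g \<in> carrier P \<Longrightarrow> w \<in> carrier P \<Longrightarrow> \<psi> g w \<in> carrier k"
  using cocycle_bits bits_closed by blast

lemma cocycle_support:
  "cocycle_over a \<psi> \<Longrightarrow> g \<in> carrier P \<Longrightarrow> w \<in> carrier P \<Longrightarrow> \<psi> g w = \<zero>\<^bsub>k\<^esub> \<or> bit_equiv w a"
  unfolding cocycle_over_def by blast

lemma cocycle_mult:
  "cocycle_over a \<psi> \<Longrightarrow> g \<in> carrier P \<Longrightarrow> h \<in> carrier P \<Longrightarrow> w \<in> carrier P \<Longrightarrow>
    \<psi> (g \<otimes> h) w = \<psi> g w \<oplus>\<^bsub>k\<^esub> \<psi> h (inv g \<otimes> w \<otimes> g)"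
  unfolding cocycle_over_def by blast

lemma bit_equiv_trans: "bit_equiv x y \<Longrightarrow> bit_equiv y z \<Longrightarrow> bit_equiv x z"
  unfolding bit_equiv_def by metis

lemma cocycle_over_equiv:
  assumes "cocycle_over a \<psi>" "bit_equiv a b" shows "cocycle_over b \<psi>"
  using assms(1) bit_equiv_trans[OF _ assms(2)] unfolding cocycle_over_def by blast

lemma cocycle_over_add:
  assumes \<psi>: "cocycle_over a \<psi>" and \<phi>: "cocycle_over a \<phi>"
  shows "cocycle_over a (\<lambda>g w. \<psi> g w \<oplus>\<^bsub>k\<^esub> \<phi> g w)"
  unfolding cocycle_over_def
proof (intro conjI ballI)
  fix g w assume gw: "g \<in> carrier P" "w \<in> carrier P"
  show "\<psi> g w \<oplus>\<^bsub>k\<^esub> \<phi> g w \<in> bits"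
    using cocycle_bits[OF \<psi> gw] cocycle_bits[OF \<phi> gw] by (rule bits_add)
  show "\<psi> g w \<oplus>\<^bsub>k\<^esub> \<phi> g w = \<zero>\<^bsub>k\<^esub> \<or> bit_equiv w a"
    using cocycle_support[OF \<psi> gw] cocycle_support[OF \<phi> gw] by auto
next
  fix g h w assume "g \<in> carrier P" "h \<in> carrier P" "w \<in> carrier P"
  then show "\<psi> (g \<otimes> h) w \<oplus>\<^bsub>k\<^esub> \<phi> (g \<otimes> h) w =
      (\<psi> g w \<oplus>\<^bsub>k\<^esub> \<phi> g w) \<oplus>\<^bsub>k\<^esub> (\<psi> h (inv g \<otimes> w \<otimes> g) \<oplus>\<^bsub>k\<^esub> \<phi> h (inv g \<otimes> w \<otimes> g))"
    using \<psi> \<phi> by (simp add: cocycle_mult[OF \<psi>] cocycle_mult[OF \<phi>] k.a_ac)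
qed

text \<open>The augmentation of \<open>\<phi>(g)\<close>.\<close>
definition trace :: "('g \<Rightarrow> 'g \<Rightarrow> 'k) \<Rightarrow> 'g \<Rightarrow> 'k"
  where "trace \<psi> g = (\<Oplus>\<^bsub>k\<^esub>w\<in>carrier P. \<psi> g w)"

text \<open>
  The augmentation is invariant under conjugation, so it turns the cocycle identity into additivity.
\<close>
lemma trace_bit_hom:
  assumes \<psi>: "cocycle_over a \<psi>" shows "bit_hom (trace \<psi>)"
  unfolding bit_hom_def
proof (intro conjI ballI)
  show "trace \<psi> g \<in> bits" if "g \<in> carrier P" for g
    unfolding trace_def using finite_P cocycle_bits[OF \<psi> that] by (rule finsum_bits)
  fix g h assume g: "g \<in> carrier P" and h: "h \<in> carrier P"
  have "trace \<psi> (g \<otimes> h) = (\<Oplus>\<^bsub>k\<^esub>w\<in>carrier P. \<psi> g w \<oplus>\<^bsub>k\<^esub> \<psi> h (inv g \<otimes> w \<otimes> g))"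
    unfolding trace_def
    by (rule finsum_k_cong) (use \<psi> g h in \<open>simp_all add: cocycle_mult[OF \<psi>]\<close>)
  also have "\<dots> = trace \<psi> g \<oplus>\<^bsub>k\<^esub> (\<Oplus>\<^bsub>k\<^esub>w\<in>carrier P. \<psi> h (inv g \<otimes> w \<otimes> g))"
    unfolding trace_def by (rule finsum_k_add) (use \<psi> g h in simp_all)
  also have "(\<Oplus>\<^bsub>k\<^esub>w\<in>carrier P. \<psi> h (inv g \<otimes> w \<otimes> g)) = trace \<psi> h"
    unfolding trace_def by (rule finsum_permute[OF bij_conj[OF g]]) (use \<psi> h in simp)
  finally show "trace \<psi> (g \<otimes> h) = trace \<psi> g \<oplus>\<^bsub>k\<^esub> trace \<psi> h" .
qed

lemma trace_add:
  assumes "cocycle_over a \<psi>" "cocycle_over a \<phi>" "g \<in> carrier P"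
  shows "trace (\<lambda>g w. \<psi> g w \<oplus>\<^bsub>k\<^esub> \<phi> g w) g = trace \<psi> g \<oplus>\<^bsub>k\<^esub> trace \<phi> g"
  unfolding trace_def by (rule finsum_k_add) (use assms in simp_all)

text \<open>
  All terms of \<open>\<phi>(g)\<close> become equal to \<open>a\<close> in \<open>V\<close>, so that in \<open>kV\<close> only their number matters.
\<close>
lemma deriv_of_symbol:
  assumes \<psi>: "cocycle_over a \<psi>" and a: "a \<in> carrier P"
  shows "deriv_of \<psi> \<in> derivations k kP" and "has_symbol (deriv_of \<psi>) a (trace \<psi>)"
proof -
  show D: "deriv_of \<psi> \<in> derivations k kP"
    by (rule deriv_of_derivation) (use \<psi> in \<open>simp_all add: cocycle_mult[OF \<psi>]\<close>)
  show "has_symbol (deriv_of \<psi>) a (trace \<psi>)"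
    unfolding has_symbol_def
  proof (intro conjI ballI funcsetI)
    show "deriv_of \<psi> z \<in> carrier kP" if "z \<in> carrier kP" for z using derivationD(1)[OF D that] .
    fix q z assume q: "q \<in> invariant_functions" and z: "z \<in> carrier kP"
    note [simp] = q z a cocycle_closed[OF \<psi>]
    let ?S = "\<lambda>f. \<Oplus>\<^bsub>k\<^esub>g\<in>carrier P. f g"
    have "pairing q (deriv_of \<psi> z) = ?S (\<lambda>u. ?S (\<lambda>g. q u \<otimes>\<^bsub>k\<^esub> (z g \<otimes>\<^bsub>k\<^esub> \<psi> g (u \<otimes> inv g))))"
      unfolding pairing_def
      by (rule finsum_k_cong) (simp_all add: deriv_of_coeff finsum_mult_left)
    also have "\<dots> = ?S (\<lambda>g. ?S (\<lambda>u. q u \<otimes>\<^bsub>k\<^esub> (z g \<otimes>\<^bsub>k\<^esub> \<psi> g (u \<otimes> inv g))))"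
      by (rule finsum_swap) simp
    also have "\<dots> = pairing (pullback a (trace \<psi>) q) z"
      unfolding pairing_def
    proof (rule finsum_k_cong)
      fix g assume g [simp]: "g \<in> carrier P"
      have "?S (\<lambda>u. q u \<otimes>\<^bsub>k\<^esub> (z g \<otimes>\<^bsub>k\<^esub> \<psi> g (u \<otimes> inv g))) =
          ?S (\<lambda>w. q (w \<otimes> g) \<otimes>\<^bsub>k\<^esub> (z g \<otimes>\<^bsub>k\<^esub> \<psi> g (w \<otimes> g \<otimes> inv g)))"
        by (rule finsum_permute[OF bij_right[OF g], symmetric]) simp
      also have "\<dots> = ?S (\<lambda>w. q (a \<otimes> g) \<otimes>\<^bsub>k\<^esub> z g \<otimes>\<^bsub>k\<^esub> \<psi> g w)"
      proof (rule finsum_k_cong)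
        fix w assume w [simp]: "w \<in> carrier P"
        have "\<psi> g w = \<zero>\<^bsub>k\<^esub> \<or> q (w \<otimes> g) = q (a \<otimes> g)"
          using cocycle_support[OF \<psi> g w] bit_equiv_mult[of w a g g] invariantD[OF q] by auto
        then show "q (w \<otimes> g) \<otimes>\<^bsub>k\<^esub> (z g \<otimes>\<^bsub>k\<^esub> \<psi> g (w \<otimes> g \<otimes> inv g)) = q (a \<otimes> g) \<otimes>\<^bsub>k\<^esub> z g \<otimes>\<^bsub>k\<^esub> \<psi> g w"
          by (auto simp: m_assoc k.m_assoc)
      qed simp
      also have "\<dots> = q (a \<otimes> g) \<otimes>\<^bsub>k\<^esub> z g \<otimes>\<^bsub>k\<^esub> trace \<psi> g"
        unfolding trace_def by (rule finsum_mult_left[symmetric]) simp_all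
      also have "\<dots> = pullback a (trace \<psi>) q g \<otimes>\<^bsub>k\<^esub> z g"
        using trace_bit_hom[OF \<psi>] by (simp add: pullback_def k.m_ac)
      finally show "?S (\<lambda>u. q u \<otimes>\<^bsub>k\<^esub> (z g \<otimes>\<^bsub>k\<^esub> \<psi> g (u \<otimes> inv g))) = pullback a (trace \<psi>) q g \<otimes>\<^bsub>k\<^esub> z g" .
    qed (use trace_bit_hom[OF \<psi>] in \<open>simp add: pullback_def\<close>)
    finally show "pairing q (deriv_of \<psi> z) = pairing (pullback a (trace \<psi>) q) z" .
  qed
qed

section \<open>Symbols from the transfer\<close>

text \<open>
  An element outside the Frattini subgroup of the abelian \<open>2\<close>-group \<open>H/H'\<close> lies outside some maximal
  subgroup, which has index two; \<open>f\<close> is the homomorphism on \<open>H\<close> with the corresponding kernel. As it is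
  additive, its value on the transfer is the sum of its values on the transfer factors.
\<close>
lemma character_detecting_transfer:
  assumes H: "subgroup H P" and ord: "order P = 2 ^ n" and y: "y \<in> carrier P"
    and tr: "transfer P H y \<notin> frattini (abelianization P H)"
  obtains T f where "right_transversal P H T" "\<And>h. h \<in> H \<Longrightarrow> f h \<in> bits"
    and "\<And>g h. g \<in> H \<Longrightarrow> h \<in> H \<Longrightarrow> f (g \<otimes> h) = f g \<oplus>\<^bsub>k\<^esub> f h"
    and "(\<Oplus>\<^bsub>k\<^esub>t\<in>T. f (transfer_factor P H T y t)) = \<one>\<^bsub>k\<^esub>"
proof -
  let ?A = "abelianization P H"
  let ?c = "\<lambda>h. derived P H #> h"
  define T where "T = (SOME T. right_transversal P H T)"
  have T: "right_transversal P H T"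
    unfolding T_def using right_transversal_exists[OF H] by (rule someI_ex)
  have Tsub: "T \<subseteq> carrier P" using T by (simp add: right_transversal_def)
  interpret A: comm_group ?A
    unfolding abelianization_def by (rule derived_quot_of_subgroup_is_comm_group[OF H])
  interpret N: normal "derived P H" "P\<lparr>carrier := H\<rparr>" by (rule derived_subgroup_is_normal[OF H])
  have coset: "?c h \<in> carrier ?A" if "h \<in> H" for h
    using that by (auto simp: abelianization_def FactGroup_def RCOSETS_def r_coset_def)
  have coset_mult: "?c g \<otimes>\<^bsub>?A\<^esub> ?c h = ?c (g \<otimes> h)" if "g \<in> H" "h \<in> H" for g h
    using N.rcos_sum[of g h] that
    by (simp add: abelianization_def FactGroup_def r_coset_def set_mult_def)
  have factor: "transfer_factor P H T y t \<in> H" if t: "t \<in> T" for t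
  proof -
    have "t \<otimes> y \<in> carrier P" using t y Tsub by auto
    then obtain s where "s \<in> T" "t \<otimes> y \<otimes> inv s \<in> H"
      using right_transversal_decomposition[OF H T] by metis
    then show ?thesis using transfer_factor_eq[OF H T y t] by metis
  qed
  have tr_eq: "transfer P H y = (\<Otimes>\<^bsub>?A\<^esub>t\<in>T. ?c (transfer_factor P H T y t))"
    by (simp add: transfer_def Let_def T_def)
  obtain m where ordA: "order ?A = 2 ^ m" using order_abelianization_power_of_two[OF H ord] ..
  have "transfer P H y \<in> carrier ?A"
    unfolding tr_eq by (rule A.finprod_closed) (use coset factor in auto)
  then obtain M where M: "maximal_subgroup M ?A" and trM: "transfer P H y \<notin> M"
    using tr by (auto simp: frattini_def)
  interpret M: subgroup M ?A using M by (simp add: maximal_subgroup_def)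
  define \<chi> where "\<chi> U = (if U \<in> M then \<zero>\<^bsub>k\<^esub> else \<one>\<^bsub>k\<^esub>)" for U
  have \<chi>_mult: "\<chi> (U \<otimes>\<^bsub>?A\<^esub> V) = \<chi> U \<oplus>\<^bsub>k\<^esub> \<chi> V" if "U \<in> carrier ?A" "V \<in> carrier ?A" for U V
    using A.mult_in_maximal_subgroup_iff[OF M ordA that] by (simp add: \<chi>_def two_eq_zero)
  have \<chi>_prod: "\<chi> (\<Otimes>\<^bsub>?A\<^esub>t\<in>S. F t) = (\<Oplus>\<^bsub>k\<^esub>t\<in>S. \<chi> (F t))"
    if "finite S" "F \<in> S \<rightarrow> carrier ?A" for S F
    using that
  proof (induction S)
    case empty then show ?case by (simp add: \<chi>_def)
  next
    case (insert s S)
    then have F: "F \<in> S \<rightarrow> carrier ?A" "F s \<in> carrier ?A" by auto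
    have "\<chi> (\<Otimes>\<^bsub>?A\<^esub>t\<in>insert s S. F t) = \<chi> (F s) \<oplus>\<^bsub>k\<^esub> \<chi> (\<Otimes>\<^bsub>?A\<^esub>t\<in>S. F t)"
      using insert.hyps F by (simp add: \<chi>_mult)
    also have "\<dots> = \<chi> (F s) \<oplus>\<^bsub>k\<^esub> (\<Oplus>\<^bsub>k\<^esub>t\<in>S. \<chi> (F t))" using insert.IH[OF F(1)] by simp
    also have "\<dots> = (\<Oplus>\<^bsub>k\<^esub>t\<in>insert s S. \<chi> (F t))"
      by (rule k.finsum_insert[symmetric]) (use insert.hyps in \<open>auto simp: \<chi>_def\<close>)
    finally show ?case .
  qed
  show thesis
  proof (rule that[OF T, of "\<lambda>h. \<chi> (?c h)"])
    show "\<chi> (?c h) \<in> bits" for h by (simp add: \<chi>_def)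
    show "\<chi> (?c (g \<otimes> h)) = \<chi> (?c g) \<oplus>\<^bsub>k\<^esub> \<chi> (?c h)" if "g \<in> H" "h \<in> H" for g h
      using coset_mult[OF that] \<chi>_mult[OF coset coset] that by metis
    have "finite T" using Tsub finite_P by (rule finite_subset)
    then have "\<chi> (transfer P H y) = (\<Oplus>\<^bsub>k\<^esub>t\<in>T. \<chi> (?c (transfer_factor P H T y t)))"
      unfolding tr_eq by (rule \<chi>_prod) (use coset factor in auto)
    then show "(\<Oplus>\<^bsub>k\<^esub>t\<in>T. \<chi> (?c (transfer_factor P H T y t))) = \<one>\<^bsub>k\<^esub>"
      using trM by (simp add: \<chi>_def)
  qed
qed

lemma centralizer_subgroup:
  assumes x: "x \<in> carrier P" shows "subgroup (centralizer P x) P"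
proof (rule subgroupI)
  have "\<one> \<in> centralizer P x" using x by (simp add: centralizer_def)
  then show "centralizer P x \<noteq> {}" by blast
  fix a assume "a \<in> centralizer P x"
  then have a: "a \<in> carrier P" "a \<otimes> x = x \<otimes> a" by (simp_all add: centralizer_def)
  have "inv a \<otimes> x = inv a \<otimes> (x \<otimes> a) \<otimes> inv a" using a(1) x by (simp add: m_assoc)
  also have "\<dots> = x \<otimes> inv a" using a(1) x by (simp add: m_assoc flip: a(2))
  finally show "inv a \<in> centralizer P x" using a by (simp add: centralizer_def)
  fix b assume "b \<in> centralizer P x"
  then have b: "b \<in> carrier P" "b \<otimes> x = x \<otimes> b" by (simp_all add: centralizer_def)
  have "a \<otimes> b \<otimes> x = a \<otimes> (x \<otimes> b)" using a b x by (simp add: m_assoc)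
  also have "\<dots> = x \<otimes> (a \<otimes> b)" using a b x by (simp flip: m_assoc)
  finally show "a \<otimes> b \<in> centralizer P x" using a b by (simp add: centralizer_def)
qed (auto simp: centralizer_def)

lemma conj_eq_iff_centralizer:
  assumes x: "x \<in> carrier P" and p: "p \<in> carrier P" and r: "r \<in> carrier P"
  shows "inv p \<otimes> x \<otimes> p = inv r \<otimes> x \<otimes> r \<longleftrightarrow> p \<otimes> inv r \<in> centralizer P x"
proof -
  have "inv p \<otimes> x \<otimes> p = inv r \<otimes> x \<otimes> r \<longleftrightarrow> p \<otimes> (inv p \<otimes> x \<otimes> p) \<otimes> inv r = p \<otimes> (inv r \<otimes> x \<otimes> r) \<otimes> inv r"
    using x p r by simp
  also have "\<dots> \<longleftrightarrow> x \<otimes> (p \<otimes> inv r) = p \<otimes> inv r \<otimes> x"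
    using x p r by (simp add: m_assoc)
  finally show ?thesis using x p r by (auto simp: centralizer_def)
qed

text \<open>
  A homomorphism \<open>f\<close> on \<open>C\<^sub>P(x)\<close> is extended to a function \<open>F\<close> on \<open>P\<close> with \<open>F(h p) = f(h) + F(p)\<close> for \<open>h\<close> in
  \<open>C\<^sub>P(x)\<close>, by setting it to zero on the transversal. For a conjugate \<open>w = p\<^sup>-\<^sup>1 x p\<close> the element \<open>p\<close> is
  determined up to left multiplication by \<open>C\<^sub>P(x)\<close>, hence \<open>F(p g) + F(p)\<close> depends only on \<open>g\<close> and \<open>w\<close>.
  This is the cocycle; its identity is a telescoping sum. Summing over the conjugates of \<open>x\<close> amounts to
  summing over the transversal, where \<open>F(t) = 0\<close> and \<open>F(t y)\<close> is \<open>f\<close> of the transfer factor.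
\<close>
lemma cocycle_of_transfer:
  assumes ord: "order P = 2 ^ n" and x: "x \<in> carrier P" and y: "y \<in> carrier P"
    and tr: "transfer P (centralizer P x) y \<notin> frattini (abelianization P (centralizer P x))"
  obtains \<psi> where "cocycle_over x \<psi>" "trace \<psi> y = \<one>\<^bsub>k\<^esub>"
proof -
  let ?C = "centralizer P x"
  let ?conj = "\<lambda>p. inv p \<otimes> x \<otimes> p"
  note C = centralizer_subgroup[OF x]
  have Csub: "h \<in> carrier P" if "h \<in> ?C" for h using that by (simp add: centralizer_def)
  obtain T f where T: "right_transversal P ?C T" and f_bits: "\<And>h. h \<in> ?C \<Longrightarrow> f h \<in> bits"
    and f_mult: "\<And>g h. g \<in> ?C \<Longrightarrow> h \<in> ?C \<Longrightarrow> f (g \<otimes> h) = f g \<oplus>\<^bsub>k\<^esub> f h"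
    and f_tr: "(\<Oplus>\<^bsub>k\<^esub>t\<in>T. f (transfer_factor P ?C T y t)) = \<one>\<^bsub>k\<^esub>"
    using character_detecting_transfer[OF C ord y tr] by metis
  have Tsub: "t \<in> carrier P" if "t \<in> T" for t using T that by (auto simp: right_transversal_def)
  have "\<exists>s. s \<in> T \<and> p \<otimes> inv s \<in> ?C \<and> (\<forall>t\<in>T. p \<otimes> inv t \<in> ?C \<longrightarrow> t = s)" if "p \<in> carrier P" for p
    using right_transversal_decomposition[OF C T that] by metis
  then obtain rep where rep: "rep p \<in> T" "p \<otimes> inv (rep p) \<in> ?C"
    and rep_unique: "t \<in> T \<Longrightarrow> p \<otimes> inv t \<in> ?C \<Longrightarrow> t = rep p" if "p \<in> carrier P" for p t
    by metis
  define F where "F p = f (p \<otimes> inv (rep p))" for p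
  have F_bits: "F p \<in> bits" if "p \<in> carrier P" for p
    unfolding F_def using f_bits rep(2) that by blast
  have Fc: "F p \<in> carrier k" if "p \<in> carrier P" for p
    using F_bits[OF that] by (rule bits_closed)
  have F_mult: "F (h \<otimes> p) = f h \<oplus>\<^bsub>k\<^esub> F p" if h: "h \<in> ?C" and p: "p \<in> carrier P" for h p
  proof -
    note hc = Csub[OF h] and sc = Tsub[OF rep(1)[OF p]]
    have eq: "h \<otimes> p \<otimes> inv (rep p) = h \<otimes> (p \<otimes> inv (rep p))" using hc p sc by (simp add: m_assoc)
    have "h \<otimes> (p \<otimes> inv (rep p)) \<in> ?C" using subgroup.m_closed[OF C h rep(2)[OF p]] .
    then have "rep (h \<otimes> p) = rep p"
      using rep_unique[of "h \<otimes> p" "rep p"] rep(1)[OF p] hc p eq by simp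
    then show ?thesis unfolding F_def using f_mult[OF h rep(2)[OF p]] eq by simp
  qed
  have f_one: "f \<one> = \<zero>\<^bsub>k\<^esub>"
  proof -
    have one: "\<one> \<in> ?C" by (rule subgroup.one_closed[OF C])
    have "f \<one> = f \<one> \<oplus>\<^bsub>k\<^esub> f \<one>" using f_mult[OF one one] by simp
    also have "\<dots> = \<zero>\<^bsub>k\<^esub>" using bits_closed[OF f_bits[OF one]] by simp
    finally show ?thesis .
  qed
  have F_T: "F t = \<zero>\<^bsub>k\<^esub>" if t: "t \<in> T" for t
  proof -
    have "rep t = t"
      using rep_unique[of t t] t Tsub[OF t] subgroup.one_closed[OF C] by simp
    then show ?thesis using Tsub[OF t] f_one by (simp add: F_def)
  qed
  define \<psi> where "\<psi> g w = (if \<exists>p\<in>carrier P. w = ?conj p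
    then F ((SOME p. p \<in> carrier P \<and> w = ?conj p) \<otimes> g) \<oplus>\<^bsub>k\<^esub> F (SOME p. p \<in> carrier P \<and> w = ?conj p)
    else \<zero>\<^bsub>k\<^esub>)" for g w
  have \<psi>_conj: "\<psi> g (?conj p) = F (p \<otimes> g) \<oplus>\<^bsub>k\<^esub> F p" if g: "g \<in> carrier P" and p: "p \<in> carrier P" for g p
  proof -
    define r where "r = (SOME r. r \<in> carrier P \<and> ?conj p = ?conj r)"
    have r: "r \<in> carrier P" "?conj p = ?conj r"
      using someI[of "\<lambda>r. r \<in> carrier P \<and> ?conj p = ?conj r" p] p unfolding r_def by blast+
    have h: "r \<otimes> inv p \<in> ?C" using conj_eq_iff_centralizer[OF x r(1) p] r(2) by simp
    have "\<psi> g (?conj p) = F (r \<otimes> g) \<oplus>\<^bsub>k\<^esub> F r" using p unfolding \<psi>_def r_def by auto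
    also have "r \<otimes> g = (r \<otimes> inv p) \<otimes> (p \<otimes> g)" using r(1) p g by (simp add: m_assoc)
    also have "F \<dots> = f (r \<otimes> inv p) \<oplus>\<^bsub>k\<^esub> F (p \<otimes> g)" by (rule F_mult[OF h]) (use p g in simp)
    also have "F r = f (r \<otimes> inv p) \<oplus>\<^bsub>k\<^esub> F p" using F_mult[OF h p] r(1) p by (simp add: m_assoc)
    finally show ?thesis
      using bits_closed[OF f_bits[OF h]] Fc[OF p] Fc[of "p \<otimes> g"] p g by (simp add: k.a_ac)
  qed
  have \<psi>_other: "\<psi> g w = \<zero>\<^bsub>k\<^esub>" if "\<not> (\<exists>p\<in>carrier P. w = ?conj p)" for g w
    using that unfolding \<psi>_def by (rule if_not_P)
  have \<psi>: "cocycle_over x \<psi>"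
    unfolding cocycle_over_def
  proof (intro conjI ballI)
    fix g w assume g: "g \<in> carrier P" and w: "w \<in> carrier P"
    show "\<psi> g w \<in> bits"
    proof (cases "\<exists>p\<in>carrier P. w = ?conj p")
      case True
      then obtain p where p: "p \<in> carrier P" "w = ?conj p" by blast
      show ?thesis unfolding p(2) \<psi>_conj[OF g p(1)]
        by (intro bits_add F_bits m_closed p(1) g)
    next
      case False then show ?thesis by (simp add: \<psi>_other)
    qed
    show "\<psi> g w = \<zero>\<^bsub>k\<^esub> \<or> bit_equiv w x"
    proof (cases "\<exists>p\<in>carrier P. w = ?conj p")
      case True
      then obtain p where p: "p \<in> carrier P" "w = ?conj p" by blast
      have "\<alpha> w = \<alpha> x" if "bit_hom \<alpha>" for \<alpha>
        using that p x by (simp add: bit_hom_mult bit_hom_inv k.a_ac)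
      then show ?thesis by (simp add: bit_equiv_def)
    next
      case False then show ?thesis by (simp add: \<psi>_other)
    qed
  next
    fix g h w assume g: "g \<in> carrier P" and h: "h \<in> carrier P" and w: "w \<in> carrier P"
    show "\<psi> (g \<otimes> h) w = \<psi> g w \<oplus>\<^bsub>k\<^esub> \<psi> h (inv g \<otimes> w \<otimes> g)"
    proof (cases "\<exists>p\<in>carrier P. w = ?conj p")
      case True
      then obtain p where p: "p \<in> carrier P" "w = ?conj p" by blast
      have "inv g \<otimes> w \<otimes> g = ?conj (p \<otimes> g)" using p g x by (simp add: m_assoc inv_mult_group)
      then have "\<psi> h (inv g \<otimes> w \<otimes> g) = F (p \<otimes> g \<otimes> h) \<oplus>\<^bsub>k\<^esub> F (p \<otimes> g)"
        using \<psi>_conj[OF h, of "p \<otimes> g"] p g by simp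
      moreover have "\<psi> g w = F (p \<otimes> g) \<oplus>\<^bsub>k\<^esub> F p" unfolding p(2) by (rule \<psi>_conj[OF g p(1)])
      moreover have "\<psi> (g \<otimes> h) w = F (p \<otimes> g \<otimes> h) \<oplus>\<^bsub>k\<^esub> F p"
        unfolding p(2) using \<psi>_conj[of "g \<otimes> h" p] p(1) g h by (simp add: m_assoc)
      ultimately show ?thesis
        using Fc[of p] Fc[of "p \<otimes> g"] Fc[of "p \<otimes> g \<otimes> h"] p(1) g h by (simp add: k.a_ac)
    next
      case False
      have "\<not> (\<exists>p\<in>carrier P. inv g \<otimes> w \<otimes> g = ?conj p)"
      proof
        assume "\<exists>p\<in>carrier P. inv g \<otimes> w \<otimes> g = ?conj p"
        then obtain p where p: "p \<in> carrier P" "inv g \<otimes> w \<otimes> g = ?conj p" by blast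
        have "w = g \<otimes> (inv g \<otimes> w \<otimes> g) \<otimes> inv g" using g w by (simp add: m_assoc)
        also have "\<dots> = ?conj (p \<otimes> inv g)"
          unfolding p(2) using p(1) g x by (simp add: m_assoc inv_mult_group)
        finally show False using False p(1) g by blast
      qed
      then show ?thesis using False by (simp add: \<psi>_other)
    qed
  qed
  have inj: "inj_on ?conj T"
  proof (rule inj_onI)
    fix s t assume s: "s \<in> T" and t: "t \<in> T" and "?conj s = ?conj t"
    then have "s \<otimes> inv t \<in> ?C" using conj_eq_iff_centralizer[OF x] Tsub by blast
    then have "t = rep s" using rep_unique[OF _ t] Tsub[OF s] by blast
    moreover have "s = rep s"
      using rep_unique[of s s] s Tsub[OF s] subgroup.one_closed[OF C] by simp
    ultimately show "s = t" by simp
  qed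
  have "trace \<psi> y = (\<Oplus>\<^bsub>k\<^esub>w\<in>?conj ` T. \<psi> y w)"
    unfolding trace_def
  proof (rule k.add.finprod_mono_neutral_cong_right)
    show "finite (carrier P)" by (rule finite_P)
    show "?conj ` T \<subseteq> carrier P" using Tsub x by auto
    show "\<psi> y \<in> carrier P \<rightarrow> carrier k" using cocycle_closed[OF \<psi> y] by blast
    show "\<psi> y w = \<zero>\<^bsub>k\<^esub>" if w: "w \<in> carrier P - ?conj ` T" for w
    proof (rule \<psi>_other)
      show "\<not> (\<exists>p\<in>carrier P. w = ?conj p)"
      proof
        assume "\<exists>p\<in>carrier P. w = ?conj p"
        then obtain p where p: "p \<in> carrier P" "w = ?conj p" by blast
        have "w = ?conj (rep p)"
          unfolding p(2) using conj_eq_iff_centralizer[OF x p(1)] rep[OF p(1)] Tsub by blast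
        then show False using w rep(1)[OF p(1)] by blast
      qed
    qed
  qed simp
  also have "\<dots> = (\<Oplus>\<^bsub>k\<^esub>t\<in>T. \<psi> y (?conj t))"
    by (rule k.finsum_reindex[OF _ inj]) (use cocycle_closed[OF \<psi> y] Tsub x in auto)
  also have "\<dots> = (\<Oplus>\<^bsub>k\<^esub>t\<in>T. f (transfer_factor P ?C T y t))"
  proof (rule finsum_k_cong)
    fix t assume t: "t \<in> T"
    have ty: "t \<otimes> y \<in> carrier P" using Tsub[OF t] y by simp
    have factor: "transfer_factor P ?C T y t = t \<otimes> y \<otimes> inv (rep (t \<otimes> y))"
      by (rule transfer_factor_eq[OF C T y t rep[OF ty]])
    show "\<psi> y (?conj t) = f (transfer_factor P ?C T y t)"
      using \<psi>_conj[OF y Tsub[OF t]] F_T[OF t] Fc[OF ty] by (simp add: factor F_def)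
    show "f (transfer_factor P ?C T y t) \<in> carrier k"
      using Fc[OF ty] by (simp add: factor F_def)
  qed
  finally show thesis using that[OF \<psi>] f_tr by simp
qed

lemma one_in_frattini: "\<one> \<in> frattini P"
  by (auto simp: frattini_def maximal_subgroup_def intro: subgroup.one_closed)

lemma frattini_coset_subset: "A \<in> carrier (P Mod frattini P) \<Longrightarrow> A \<subseteq> carrier P"
  using r_coset_subset_G[OF frattini_subset] by (auto simp: FactGroup_def RCOSETS_def)

lemma frattini_coset_nonempty: "A \<in> carrier (P Mod frattini P) \<Longrightarrow> A \<noteq> {}"
  using one_in_frattini by (auto simp: FactGroup_def RCOSETS_def r_coset_def)

lemma Gamma_edge_cocycle:
  assumes ord: "order P = 2 ^ n" and edge: "(A, B) \<in> parcs (Gamma P)" and a: "a \<in> A" and b: "b \<in> B"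
  obtains \<psi> where "cocycle_over a \<psi>" "trace \<psi> b = \<one>\<^bsub>k\<^esub>"
proof -
  obtain x y where x: "x \<in> carrier P" and y: "y \<in> carrier P"
    and AB: "A = frattini P #> x" "B = frattini P #> y"
    and tr: "transfer P (centralizer P x) y \<notin> frattini (abelianization P (centralizer P x))"
    using edge by (auto simp: Gamma_def)
  obtain \<psi> where \<psi>: "cocycle_over x \<psi>" "trace \<psi> y = \<one>\<^bsub>k\<^esub>"
    using cocycle_of_transfer[OF ord x y tr] .
  have "bit_equiv a x" "bit_equiv b y"
    using bit_equiv_frattini_coset a b x y AB by auto
  then have "bit_equiv x a" and "trace \<psi> b = \<one>\<^bsub>k\<^esub>"
    using trace_bit_hom[OF \<psi>(1)] \<psi>(2) unfolding bit_equiv_def by metis+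
  then show thesis using that cocycle_over_equiv[OF \<psi>(1)] by blast
qed

text \<open>
  The condition \<open>\<alpha>(a) = 0\<close> is a way to say \<open>\<alpha>(a b) = 1\<close>, given that \<open>\<alpha>(b) = 1\<close>. The two edges of
  \<open>\<Gamma>(P)\<close> provide a cocycle for each of the values at \<open>b\<close> and at \<open>a b\<close>; if neither is suitable, their
  sum is.
\<close>
lemma Gamma2_edge_derivation:
  assumes ord: "order P = 2 ^ n" and edge: "(A, B) \<in> parcs (Gamma2 P)" and a: "a \<in> A" and b: "b \<in> B"
  obtains D \<alpha> where "D \<in> derivations k kP" "bit_hom \<alpha>" "has_symbol D a \<alpha>" "\<alpha> b = \<one>\<^bsub>k\<^esub>" "\<alpha> a = \<zero>\<^bsub>k\<^esub>"
proof -
  have edges: "(A, B) \<in> parcs (Gamma P)" "(A, A \<otimes>\<^bsub>P Mod frattini P\<^esub> B) \<in> parcs (Gamma P)"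
    and AB: "A \<in> carrier (P Mod frattini P)" "B \<in> carrier (P Mod frattini P)"
    using edge by (auto simp: Gamma2_def)
  have ac: "a \<in> carrier P" and bc: "b \<in> carrier P" using frattini_coset_subset AB a b by blast+
  have ab: "a \<otimes> b \<in> A \<otimes>\<^bsub>P Mod frattini P\<^esub> B"
    using a b by (auto simp: FactGroup_def set_mult_def)
  obtain \<psi> where \<psi>: "cocycle_over a \<psi>" "trace \<psi> b = \<one>\<^bsub>k\<^esub>"
    using Gamma_edge_cocycle[OF ord edges(1) a b] .
  obtain \<phi> where \<phi>: "cocycle_over a \<phi>" "trace \<phi> (a \<otimes> b) = \<one>\<^bsub>k\<^esub>"
    using Gamma_edge_cocycle[OF ord edges(2) a ab] .
  note hom = trace_bit_hom[OF \<psi>(1)] trace_bit_hom[OF \<phi>(1)]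
  note bits = bit_hom_bits[OF hom(1) ac] bit_hom_bits[OF hom(2) ac] bit_hom_bits[OF hom(2) bc]
  have sum: "trace \<phi> a \<oplus>\<^bsub>k\<^esub> trace \<phi> b = \<one>\<^bsub>k\<^esub>"
    using \<phi>(2) bit_hom_mult[OF hom(2) ac bc] by simp
  have "\<exists>\<theta>. cocycle_over a \<theta> \<and> trace \<theta> b = \<one>\<^bsub>k\<^esub> \<and> trace \<theta> a = \<zero>\<^bsub>k\<^esub>"
  proof (cases "trace \<psi> a = \<zero>\<^bsub>k\<^esub>")
    case True then show ?thesis using \<psi> by blast
  next
    case False
    then have \<psi>a: "trace \<psi> a = \<one>\<^bsub>k\<^esub>" using bits by simp
    show ?thesis
    proof (cases "trace \<phi> a = \<zero>\<^bsub>k\<^esub>")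
      case True
      then have "trace \<phi> b = \<one>\<^bsub>k\<^esub>" using sum bits(3) bits_closed by simp
      then show ?thesis using \<phi>(1) True by blast
    next
      case False
      then have \<phi>a: "trace \<phi> a = \<one>\<^bsub>k\<^esub>" using bits by simp
      have "trace \<phi> b = \<zero>\<^bsub>k\<^esub>" using sum bits(3) \<phi>a two_eq_zero by auto
      then have "trace (\<lambda>g w. \<psi> g w \<oplus>\<^bsub>k\<^esub> \<phi> g w) b = \<one>\<^bsub>k\<^esub>"
        "trace (\<lambda>g w. \<psi> g w \<oplus>\<^bsub>k\<^esub> \<phi> g w) a = \<zero>\<^bsub>k\<^esub>"
        using \<psi>(2) \<psi>a \<phi>a by (simp_all add: trace_add[OF \<psi>(1) \<phi>(1)] ac bc)
      then show ?thesis using cocycle_over_add[OF \<psi>(1) \<phi>(1)] by blast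
    qed
  qed
  then obtain \<theta> where \<theta>: "cocycle_over a \<theta>" "trace \<theta> b = \<one>\<^bsub>k\<^esub>" "trace \<theta> a = \<zero>\<^bsub>k\<^esub>" by blast
  show thesis
    by (rule that[OF deriv_of_symbol(1)[OF \<theta>(1) ac] trace_bit_hom[OF \<theta>(1)]
          deriv_of_symbol(2)[OF \<theta>(1) ac] \<theta>(2,3)])
qed

section \<open>Symbols in the derived series\<close>

text \<open>
  For sets of operators, such as classes modulo inner derivations. Asking this of all elements makes
  it stable under the bracket of classes, which is a union over all representatives, without first
  showing that this bracket is well defined.
\<close>
definition realizes :: "(('g \<Rightarrow> 'k) \<Rightarrow> 'g \<Rightarrow> 'k) set \<Rightarrow> 'g \<Rightarrow> ('g \<Rightarrow> 'k) \<Rightarrow> bool"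
  where "realizes S a \<alpha> \<longleftrightarrow> S \<noteq> {} \<and> (\<forall>D\<in>S. has_symbol D a \<alpha>)"

lemma HH1_simps:
  "carrier (HH1 k kP) = (\<lambda>D. InnDer kP +>\<^bsub>Der k kP\<^esub> D) ` derivations k kP"
  "S \<otimes>\<^bsub>HH1 k kP\<^esub> S' = (\<Union>D\<in>S. \<Union>E\<in>S'. InnDer kP +>\<^bsub>Der k kP\<^esub> (D \<otimes>\<^bsub>Der k kP\<^esub> E))"
  "\<zero>\<^bsub>HH1 k kP\<^esub> = InnDer kP"
  by (auto simp: HH1_def quot_algebra_def ring.defs FactRing_def rcoset_mult_def A_RCOSETS_def'
      Der_def)

lemma InnDer_nonempty: "InnDer kP \<noteq> {}"
proof -
  have "\<zero>\<^bsub>kP\<^esub> \<in> carrier kP" by (simp add: group_algebra_def)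
  then show ?thesis by (auto simp: InnDer_def)
qed

lemma realizes_coset:
  assumes "has_symbol D a \<alpha>" shows "realizes (InnDer kP +>\<^bsub>Der k kP\<^esub> D) a \<alpha>"
  using InnDer_nonempty has_symbol_add_inner[OF assms]
  by (auto simp: realizes_def a_r_coset_def')

lemma realizes_UN:
  assumes "I \<noteq> {}" "\<And>i. i \<in> I \<Longrightarrow> realizes (F i) a \<alpha>"
  shows "realizes (\<Union>i\<in>I. F i) a \<alpha>"
  using assms by (auto simp: realizes_def)

lemma realizes_bracket:
  assumes S: "realizes S a \<alpha>" and S': "realizes S' b \<beta>"
    and "a \<in> carrier P" "b \<in> carrier P" "bit_hom \<alpha>" "bit_hom \<beta>"
  shows "realizes (S \<otimes>\<^bsub>HH1 k kP\<^esub> S') (a \<otimes> b) (\<lambda>g. \<alpha> b \<otimes>\<^bsub>k\<^esub> \<beta> g \<oplus>\<^bsub>k\<^esub> \<beta> a \<otimes>\<^bsub>k\<^esub> \<alpha> g)"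
proof -
  have "realizes (InnDer kP +>\<^bsub>Der k kP\<^esub> (D \<otimes>\<^bsub>Der k kP\<^esub> E)) (a \<otimes> b)
      (\<lambda>g. \<alpha> b \<otimes>\<^bsub>k\<^esub> \<beta> g \<oplus>\<^bsub>k\<^esub> \<beta> a \<otimes>\<^bsub>k\<^esub> \<alpha> g)" if "D \<in> S" "E \<in> S'" for D E
    by (rule realizes_coset, rule has_symbol_bracket) (use assms that in \<open>auto simp: realizes_def\<close>)
  moreover have "S \<noteq> {}" "S' \<noteq> {}" using S S' by (simp_all add: realizes_def)
  ultimately show ?thesis unfolding HH1_simps(2) by (intro realizes_UN)
qed

text \<open>
  On \<open>kV\<close> inner derivations act by zero, whereas an operator with the given symbol sends \<open>b\<close> to
  \<open>\<alpha>(b) a b\<close>.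
\<close>
lemma InnDer_not_realizes:
  assumes S: "realizes (InnDer kP) a \<alpha>" and a: "a \<in> carrier P" and \<alpha>: "bit_hom \<alpha>" and b: "b \<in> carrier P"
  shows "\<alpha> b = \<zero>\<^bsub>k\<^esub>"
proof -
  \<comment> \<open>The augmentation of \<open>kP\<close>, evaluated on the group element \<open>b\<close>.\<close>
  define q :: "'g \<Rightarrow> 'k" where "q = (\<lambda>_. \<one>\<^bsub>k\<^esub>)"
  define z where "z = (\<lambda>g\<in>carrier P. if b = g then \<one>\<^bsub>k\<^esub> else \<zero>\<^bsub>k\<^esub>)"
  have q: "q \<in> invariant_functions" by (simp add: q_def invariant_functions_def)
  have z: "z \<in> carrier kP" by (simp add: z_def carrier_kP)
  obtain i where i: "i \<in> InnDer kP" using InnDer_nonempty by blast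
  then have "has_symbol i a \<alpha>" using S by (simp add: realizes_def)
  then have "pairing (pullback a \<alpha> q) z = pairing q (i z)"
    using q z by (simp add: has_symbol_def)
  also have "\<dots> = \<zero>\<^bsub>k\<^esub>" using inner_derivation_pairing(2)[OF i z q] .
  finally have "pairing (pullback a \<alpha> q) z = \<zero>\<^bsub>k\<^esub>" .
  moreover have "pairing (pullback a \<alpha> q) z = (\<Oplus>\<^bsub>k\<^esub>g\<in>carrier P. if b = g then \<alpha> g else \<zero>\<^bsub>k\<^esub>)"
    unfolding pairing_def
    by (rule finsum_k_cong) (use \<alpha> in \<open>simp_all add: pullback_def q_def z_def\<close>)
  moreover have "\<dots> = \<alpha> b"
    by (rule k.finsum_singleton) (use b finite_P \<alpha> in auto)
  ultimately show ?thesis by simp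
qed

lemma lie_derived_bracket:
  "S \<in> M \<Longrightarrow> S' \<in> M \<Longrightarrow> S \<otimes>\<^bsub>L\<^esub> S' \<in> lie_derived R L M"
  unfolding lie_derived_def by (rule subsetD[OF hull_subset]) blast

text \<open>
  The induction along the derived series carries two families of symbols: those at vertices \<open>v\<close> in \<open>V\<close>,
  and those of the brackets of two of them. If \<open>D\<close> is the derivation attached to a predecessor \<open>u\<close> of
  \<open>v\<close>, then a class with the symbol of \<open>[D, E]\<close> is available at level \<open>n\<close> by the second family, and its
  bracket with \<open>D\<close> returns the symbol of \<open>E\<close> at level \<open>n + 1\<close>. Carrying both families makes it
  unnecessary to compare the terms of the series with each other.
\<close>
lemma not_solvable_if_predecessors:
  assumes "V \<noteq> {}" and V: "V \<subseteq> carrier P"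
    and pred: "\<And>v. v \<in> V \<Longrightarrow> \<exists>u\<in>V. \<exists>D\<in>derivations k kP. \<exists>\<alpha>.
      bit_hom \<alpha> \<and> has_symbol D u \<alpha> \<and> \<alpha> v = \<one>\<^bsub>k\<^esub> \<and> \<alpha> u = \<zero>\<^bsub>k\<^esub>"
  shows "\<not> lie_solvable k (HH1 k kP)"
proof
  define L where "L = HH1 k kP"
  define realizable where "realizable a \<alpha> \<longleftrightarrow> a \<in> V \<and> bit_hom \<alpha> \<and> (\<exists>D\<in>derivations k kP. has_symbol D a \<alpha>)" for a \<alpha>
  define weight where "weight u \<alpha> v \<beta> = (\<lambda>g. \<alpha> v \<otimes>\<^bsub>k\<^esub> \<beta> g \<oplus>\<^bsub>k\<^esub> \<beta> u \<otimes>\<^bsub>k\<^esub> \<alpha> g)" for u v :: 'g and \<alpha> \<beta> :: "'g \<Rightarrow> 'k"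
  let ?M = "\<lambda>n. (lie_derived k L ^^ n) (carrier L)"
  have realizableD: "a \<in> carrier P" "bit_hom \<alpha>" if "realizable a \<alpha>" for a \<alpha>
    using that V by (auto simp: realizable_def)
  have weight_hom: "bit_hom (weight u \<alpha> v \<beta>)" if "realizable u \<alpha>" "realizable v \<beta>" for u \<alpha> v \<beta>
    unfolding weight_def by (intro bit_hom_bracket bit_hom_bits) (use that realizableD in blast)+
  have inv: "(\<forall>v \<beta>. realizable v \<beta> \<longrightarrow> (\<exists>S\<in>?M n. realizes S v \<beta>)) \<and>
      (\<forall>u \<alpha> v \<beta>. realizable u \<alpha> \<longrightarrow> realizable v \<beta> \<longrightarrow> (\<exists>S\<in>?M n. realizes S (u \<otimes> v) (weight u \<alpha> v \<beta>)))" for n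
  proof (induction n)
    case 0
    have coset: "\<exists>S\<in>carrier L. realizes S a \<alpha>" if "D \<in> derivations k kP" "has_symbol D a \<alpha>" for D a \<alpha>
      using that realizes_coset unfolding L_def HH1_simps by blast
    have "\<exists>S\<in>carrier L. realizes S (u \<otimes> v) (weight u \<alpha> v \<beta>)" if u: "realizable u \<alpha>" and v: "realizable v \<beta>" for u \<alpha> v \<beta>
    proof -
      obtain D E where D: "D \<in> derivations k kP" "has_symbol D u \<alpha>"
        and E: "E \<in> derivations k kP" "has_symbol E v \<beta>" using u v by (auto simp: realizable_def)
      show ?thesis unfolding weight_def
        by (rule coset[OF bracket_derivation[OF D(1) E(1)]
              has_symbol_bracket[OF D(2) E(2) realizableD(1)[OF u] realizableD(1)[OF v] realizableD(2)[OF u] realizableD(2)[OF v]]])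
    qed
    then show ?case using coset by (auto simp: realizable_def)
  next
    case (Suc n)
    have M: "S \<otimes>\<^bsub>L\<^esub> S' \<in> ?M (Suc n)" if "S \<in> ?M n" "S' \<in> ?M n" for S S'
      using lie_derived_bracket[OF that] by simp
    have 1: "\<exists>S\<in>?M (Suc n). realizes S (u \<otimes> v) (weight u \<alpha> v \<beta>)" if u: "realizable u \<alpha>" and v: "realizable v \<beta>" for u \<alpha> v \<beta>
    proof -
      obtain S S' where S: "S \<in> ?M n" "realizes S u \<alpha>" and S': "S' \<in> ?M n" "realizes S' v \<beta>"
        using Suc u v by blast
      have "realizes (S \<otimes>\<^bsub>L\<^esub> S') (u \<otimes> v) (weight u \<alpha> v \<beta>)"
        unfolding L_def weight_def by (rule realizes_bracket[OF S(2) S'(2)]) (use realizableD u v in blast)+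
      then show ?thesis using M[OF S(1) S'(1)] by blast
    qed
    have 2: "\<exists>S\<in>?M (Suc n). realizes S v \<beta>" if v: "realizable v \<beta>" for v \<beta>
    proof -
      have vV: "v \<in> V" using v by (simp add: realizable_def)
      obtain u \<alpha> where u: "realizable u \<alpha>" and \<alpha>v: "\<alpha> v = \<one>\<^bsub>k\<^esub>" and \<alpha>u: "\<alpha> u = \<zero>\<^bsub>k\<^esub>"
        using pred[OF vV] unfolding realizable_def by blast
      note uc = realizableD(1)[OF u] and vc = realizableD(1)[OF v] and \<alpha> = realizableD(2)[OF u] and \<beta> = realizableD(2)[OF v]
      let ?\<nu> = "weight u \<alpha> v \<beta>"
      obtain S S' where S: "S \<in> ?M n" "realizes S u \<alpha>" and S': "S' \<in> ?M n" "realizes S' (u \<otimes> v) ?\<nu>"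
        using Suc u v by blast
      have real: "realizes (S \<otimes>\<^bsub>L\<^esub> S') (u \<otimes> (u \<otimes> v)) (weight u \<alpha> (u \<otimes> v) ?\<nu>)"
        unfolding L_def weight_def[of u \<alpha> "u \<otimes> v" ?\<nu>]
        by (rule realizes_bracket[OF S(2) S'(2)]) (use uc vc \<alpha> weight_hom[OF u v] in simp_all)
      have "bit_equiv (u \<otimes> (u \<otimes> v)) v"
        using uc vc by (simp add: bit_equiv_def bit_hom_mult)
      \<comment> \<open>Here \<open>\<alpha>(u v) = 1\<close>, \<open>\<nu> = \<beta> + \<beta>(u) \<alpha>\<close> and \<open>\<nu>(u) = \<beta>(u)\<close>, so the result is \<open>\<nu> + \<beta>(u) \<alpha> = \<beta>\<close>.\<close>
      moreover have "weight u \<alpha> (u \<otimes> v) ?\<nu> g = \<beta> g" if g: "g \<in> carrier P" for g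
        using g uc vc \<alpha> \<beta> \<alpha>v \<alpha>u by (simp add: weight_def bit_hom_mult k.a_ac)
      moreover have "bit_hom (weight u \<alpha> (u \<otimes> v) ?\<nu>)"
        unfolding weight_def[of u \<alpha> "u \<otimes> v" ?\<nu>]
        by (rule bit_hom_bracket) (use \<alpha> weight_hom[OF u v] uc vc in \<open>simp_all add: bit_hom_bits del: insert_iff\<close>)
      ultimately have "has_symbol D v \<beta>" if "has_symbol D (u \<otimes> (u \<otimes> v)) (weight u \<alpha> (u \<otimes> v) ?\<nu>)" for D
        using has_symbol_cong[OF that] uc vc \<beta> by blast
      then have "realizes (S \<otimes>\<^bsub>L\<^esub> S') v \<beta>" using real by (simp add: realizes_def)
      then show ?thesis using M[OF S(1) S'(1)] by blast
    qed
    show ?case using 1 2 by blast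
  qed
  assume "lie_solvable k (HH1 k kP)"
  then obtain n where n: "?M n = {InnDer kP}"
    unfolding lie_solvable_def L_def HH1_simps by blast
  obtain v where v: "v \<in> V" using assms(1) by blast
  obtain u \<alpha> where u: "realizable u \<alpha>" and \<alpha>v: "\<alpha> v = \<one>\<^bsub>k\<^esub>"
    using pred[OF v] unfolding realizable_def by blast
  have "realizes (InnDer kP) u \<alpha>" using inv[of n] u n by auto
  then have "\<alpha> v = \<zero>\<^bsub>k\<^esub>" using InnDer_not_realizes realizableD[OF u] v V by blast
  then show False using \<alpha>v by simp
qed

end

theorem corollary1p6:
  fixes k :: "('k, 'n) ring_scheme" and P :: "('g, 'm) monoid_scheme"
  assumes "field k" and "characteristic k = 2"
    and "group P" and "finite (carrier P)" and "\<exists>n::nat. order P = 2 ^ n"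
    and "\<exists>c. pre_digraph.cycle (with_proj (Gamma2 P)) c"
  shows "\<not> lie_solvable k (HH1 k (group_algebra k P))"
proof -
  interpret k: field k by fact
  have "add_pow k (2::nat) \<one>\<^bsub>k\<^esub> = \<zero>\<^bsub>k\<^esub>"
    using k.add.pow_ord_eq_1[OF k.one_closed] assms(2)[unfolded characteristic_def]
    by (simp only:)
  then have "\<one>\<^bsub>k\<^esub> \<oplus>\<^bsub>k\<^esub> \<one>\<^bsub>k\<^esub> = \<zero>\<^bsub>k\<^esub>"
    by (simp add: numeral_2_eq_2)
  then interpret char2_group_algebra P k
    using assms by (simp add: char2_group_algebra_def char2_group_algebra_axioms_def)
  obtain n where ord: "order P = 2 ^ n" using assms(5) ..
  let ?\<Gamma> = "Gamma2 P"
  interpret \<Gamma>: pair_wf_digraph ?\<Gamma>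
    by unfold_locales (auto simp: Gamma2_def)
  obtain A where loop: "(A, A) \<in> (parcs ?\<Gamma>)\<^sup>+"
    using assms(6) \<Gamma>.reachable1_awalk unfolding \<Gamma>.cycle_def by auto
  define rep :: "'g set \<Rightarrow> 'g" where "rep B = (SOME b. b \<in> B)" for B
  have rep: "rep B \<in> B" if "B \<in> pverts ?\<Gamma>" for B
    using that frattini_coset_nonempty unfolding rep_def by (simp add: Gamma2_def some_in_eq)
  \<comment> \<open>Representatives of the vertices on cycles: each has a predecessor that is again on a cycle.\<close>
  define V where "V = rep ` {B. (B, B) \<in> (parcs ?\<Gamma>)\<^sup>+}"
  have on_cycle: "B \<in> pverts ?\<Gamma>" if "(B, B) \<in> (parcs ?\<Gamma>)\<^sup>+" for B
    using tranclD[OF that] \<Gamma>.in_arcsD1 by blast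
  show ?thesis
  proof (rule not_solvable_if_predecessors[of V])
    show "V \<noteq> {}" using loop by (auto simp: V_def)
    show "V \<subseteq> carrier P"
    proof
      fix v assume "v \<in> V"
      then obtain B where B: "(B, B) \<in> (parcs ?\<Gamma>)\<^sup>+" "v = rep B" by (auto simp: V_def)
      have "B \<in> carrier (P Mod frattini P)" using on_cycle[OF B(1)] by (simp add: Gamma2_def)
      then show "v \<in> carrier P" using frattini_coset_subset rep[OF on_cycle[OF B(1)]] B(2) by blast
    qed
    fix v assume "v \<in> V"
    then obtain B where B: "(B, B) \<in> (parcs ?\<Gamma>)\<^sup>+" "v = rep B" by (auto simp: V_def)
    obtain U where U: "(B, U) \<in> (parcs ?\<Gamma>)\<^sup>*" "(U, B) \<in> parcs ?\<Gamma>" using tranclD2[OF B(1)] by blast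
    then have UU: "(U, U) \<in> (parcs ?\<Gamma>)\<^sup>+" by (rule rtrancl_into_trancl2[rotated])
    obtain D \<alpha> where "D \<in> derivations k (group_algebra k P)" "bit_hom \<alpha>" "has_symbol D (rep U) \<alpha>"
      "\<alpha> (rep B) = \<one>\<^bsub>k\<^esub>" "\<alpha> (rep U) = \<zero>\<^bsub>k\<^esub>"
      using Gamma2_edge_derivation[OF ord U(2) rep[OF on_cycle[OF UU]] rep[OF on_cycle[OF B(1)]]] .
    then show "\<exists>u\<in>V. \<exists>D\<in>derivations k (group_algebra k P). \<exists>\<alpha>.
        bit_hom \<alpha> \<and> has_symbol D u \<alpha> \<and> \<alpha> v = \<one>\<^bsub>k\<^esub> \<and> \<alpha> u = \<zero>\<^bsub>k\<^esub>"
      using UU B(2) unfolding V_def by blast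
  qed
qed

end
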